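(* Assume $H\in(\tfrac12,1)$, $\alpha>0$ and $\alpha+2H>2$, and let $\hat\beta>0$, $\hat h\in\mathbb R$. Then the family $\big\{\tilde Z^{\omega,h_N}_{N,\beta_N}\big\}_{N\in\mathbb N}$ of rescaled Wick-ordered partition functions is uniformly integrable.
   Context: Model. $\mathbb N=\{1,2,\dots\}$, $\mathbb N_0=\{0,1,2,\dots\}$. $L:(0,\infty)\to(0,\infty)$ is slowly varying, i.e. $\lim_{t\to\infty}L(at)/L(t)=1$ for every $a>0$. $\tau=\{\tau_i\}_{i\in\mathbb N_0}$ is a renewal process with $\tau_0=0$, i.i.d. increments, $\mathbb P_\tau(\tau_1=n)=L(n)/n^{1+\alpha}$ for $n\ge1$, and $\mathbb P_\tau(\tau_1<\infty)=1$; $\tau$ also denotes the random set $\{\tau_0,\tau_1,\dots\}$. Set $l(N):=\sum_{n=1}^N L(n)/n$. $\omega=\{\omega_n\}_{n\in\mathbb N}$ is a jointly Gaussian family, independent of $\tau$, with $\mathbb E_\omega[\omega_n]=0$ and $\mathbb E_\omega[\omega_n\omega_{n'}]=\gamma(n-n')$, where for some constant $C$, $\gamma(n)\le C(|n|^{2H-2}\wedge1)$ for all $n\in\mathbb Z$ (the minimum being $1$ at $n=0$), and $\lim_{N\to\infty}N^{2-2H}\gamma([Nt])=|t|^{2H-2}$ for all $t\ne0$ ($[\cdot]$ is the integer part). Wick-ordered partition function: $$\tilde Z^{\omega,h}_{N,\beta}:=\mathbb E_\tau\Big[\exp\Big\{\sum_{n=1}^N(\beta\omega_n+h)\mathbf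 1_{\{n\in\tau\}}-\tfrac12\beta^2\sum_{n,m=1}^N\gamma(n-m)\mathbf 1_{\{n\in\tau\}}\mathbf 1_{\{m\in\tau\}}\Big\}\Big].$$ Scalings: if $0<\alpha<1$, $\beta_N=\hat\beta L(N)N^{-(\alpha+H-1)}$ and $h_N=\hat hL(N)N^{-\alpha}$; if $\mathbb E[\tau_1]<\infty$, $\beta_N=\hat\beta N^{-H}$ and $h_N=\hat hN^{-1}$; if $\alpha=1$ and $\mathbb E[\tau_1]=\infty$, $\beta_N=\hat\beta\,l(N)N^{-H}$ and $h_N=\hat h\,l(N)N^{-1}$.
   Formalization: The slowly varying function L is additionally assumed Borel measurable on (0,∞), as is usual for slow variation; with only the limit L(at)/L(t)→1 for each a>0 there are non-measurable L for which the family is not uniformly integrable. *)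

theory Defs
  imports "HOL-Probability.Probability"
begin

(* Borel measurability is part of the usual notion of slow variation (Karamata theory).
   Without it the limit relation does not even control the restriction of L to the integers. *)
definition slowly_varying :: "(real \<Rightarrow> real) \<Rightarrow> bool" where
  "slowly_varying L \<longleftrightarrow>
     (\<forall>t>0. L t > 0) \<and>
     L \<in> borel_measurable (restrict_space borel {0<..}) \<and>
     (\<forall>a>0. ((\<lambda>t. L (a * t) / L t) \<longlongrightarrow> 1) at_top)"

(* The i.i.d. increments \<xi> live in {1, 2, ...} together with infinity, so that
   finiteness of the first renewal time remains a separate condition. *)
definition renewal_process :: "'a measure \<Rightarrow> (nat \<Rightarrow> 'a \<Rightarrow> enat) \<Rightarrow> bool" where
  "renewal_process M \<tau> \<longleftrightarrow>
     prob_space M \<and>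
     (\<exists>\<xi>. prob_space.indep_vars M (\<lambda>_. count_space UNIV) \<xi> UNIV \<and>
          (\<forall>i. distr M (count_space UNIV) (\<xi> i) = distr M (count_space UNIV) (\<xi> 0)) \<and>
          (\<forall>i. AE x in M. 1 \<le> \<xi> i x) \<and>
          (\<forall>i. \<forall>x\<in>space M. \<tau> i x = (\<Sum>j<i. \<xi> j x)))"

definition renewal_set :: "(nat \<Rightarrow> 'a \<Rightarrow> enat) \<Rightarrow> 'a \<Rightarrow> nat set" where
  "renewal_set \<tau> x = {n. \<exists>i. \<tau> i x = enat n}"

definition mean_return_time :: "'a measure \<Rightarrow> (nat \<Rightarrow> 'a \<Rightarrow> enat) \<Rightarrow> ennreal" where
  "mean_return_time M \<tau> = (\<integral>\<^sup>+ x. ennreal_of_enat (\<tau> 1 x) \<partial>M)"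

(* Degenerate (almost surely constant) variables count as Gaussian. *)
definition gaussian_rv :: "'b measure \<Rightarrow> ('b \<Rightarrow> real) \<Rightarrow> bool" where
  "gaussian_rv P X \<longleftrightarrow>
     X \<in> borel_measurable P \<and>
     ((\<exists>\<mu> \<sigma>. \<sigma> > 0 \<and> distributed P lborel X (normal_density \<mu> \<sigma>)) \<or>
      (\<exists>c. AE w in P. X w = c))"

definition jointly_gaussian ::
    "'b measure \<Rightarrow> 'i set \<Rightarrow> ('i \<Rightarrow> 'b \<Rightarrow> real) \<Rightarrow> bool" where
  "jointly_gaussian P I X \<longleftrightarrow>
     (\<forall>F c. finite F \<and> F \<subseteq> I \<longrightarrow> gaussian_rv P (\<lambda>w. \<Sum>i\<in>F. c i * X i w))"

(* The case n = 0 is separate because 0 powr a = 0 in HOL. *)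
definition correlation_bound :: "real \<Rightarrow> int \<Rightarrow> real" where
  "correlation_bound H n =
     (if n = 0 then 1 else min (\<bar>real_of_int n\<bar> powr (2 * H - 2)) 1)"

definition gaussian_disorder ::
    "'b measure \<Rightarrow> (nat \<Rightarrow> 'b \<Rightarrow> real) \<Rightarrow> (int \<Rightarrow> real) \<Rightarrow> real \<Rightarrow> bool" where
  "gaussian_disorder P \<omega> \<gamma> H \<longleftrightarrow>
     prob_space P \<and>
     jointly_gaussian P {1..} \<omega> \<and>
     (\<forall>n\<ge>1. (\<integral>w. \<omega> n w \<partial>P) = 0) \<and>
     (\<forall>n\<ge>1. \<forall>n'\<ge>1. (\<integral>w. \<omega> n w * \<omega> n' w \<partial>P) = \<gamma> (int n - int n')) \<and>
     (\<exists>C. \<forall>n. \<gamma> n \<le> C * correlation_bound H n) \<and>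
     (\<forall>t. t \<noteq> 0 \<longrightarrow>
        (\<lambda>N. real N powr (2 - 2 * H) * \<gamma> \<lfloor>real N * t\<rfloor>) \<longlonglongrightarrow> \<bar>t\<bar> powr (2 * H - 2))"

(* e is one realization of the disorder; the expectation is over the renewal process only. *)
definition wick_partition ::
    "'a measure \<Rightarrow> (nat \<Rightarrow> 'a \<Rightarrow> enat) \<Rightarrow> (int \<Rightarrow> real) \<Rightarrow> (nat \<Rightarrow> real) \<Rightarrow>
     real \<Rightarrow> real \<Rightarrow> nat \<Rightarrow> real" where
  "wick_partition M \<tau> \<gamma> e h \<beta> N =
     (\<integral>x. exp ((\<Sum>n=1..N. (\<beta> * e n + h) * indicator (renewal_set \<tau> x) n)
            - 1 / 2 * \<beta>\<^sup>2 * (\<Sum>n=1..N. \<Sum>m=1..N. \<gamma> (int n - int m) *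
                 indicator (renewal_set \<tau> x) n * indicator (renewal_set \<tau> x) m)) \<partial>M)"

definition log_partial_sum :: "(real \<Rightarrow> real) \<Rightarrow> nat \<Rightarrow> real" where
  "log_partial_sum L N = (\<Sum>n=1..N. L (real n) / real n)"

(* In both scalings m is the mean return time and \<alpha> > 0. The last branch is the case
   \<alpha> = 1, m = \<infinity>, because \<alpha> > 1 forces m to be finite for the laws considered. *)
definition disorder_scaling ::
    "real \<Rightarrow> real \<Rightarrow> (real \<Rightarrow> real) \<Rightarrow> ennreal \<Rightarrow> real \<Rightarrow> nat \<Rightarrow> real" where
  "disorder_scaling \<alpha> H L m \<beta>0 N =
     (if \<alpha> < 1 then \<beta>0 * L (real N) * real N powr (- (\<alpha> + H - 1))
      else if m < \<infinity> then \<beta>0 * real N powr (- H)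
      else \<beta>0 * log_partial_sum L N * real N powr (- H))"

definition pinning_scaling ::
    "real \<Rightarrow> (real \<Rightarrow> real) \<Rightarrow> ennreal \<Rightarrow> real \<Rightarrow> nat \<Rightarrow> real" where
  "pinning_scaling \<alpha> L m h0 N =
     (if \<alpha> < 1 then h0 * L (real N) * real N powr (- \<alpha>)
      else if m < \<infinity> then h0 * real N powr (- 1)
      else h0 * log_partial_sum L N * real N powr (- 1))"

definition uniformly_integrable ::
    "'b measure \<Rightarrow> 'i set \<Rightarrow> ('i \<Rightarrow> 'b \<Rightarrow> real) \<Rightarrow> bool" where
  "uniformly_integrable P I X \<longleftrightarrow>
     (\<forall>i\<in>I. integrable P (X i)) \<and>
     ((\<lambda>K. SUP i\<in>I. \<integral>\<^sup>+ w. ennreal \<bar>X i w\<bar> * indicator {w. \<bar>X i w\<bar> > K} w \<partial>P)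
        \<longlongrightarrow> 0) (at_top :: real filter)"

end

theory Submission
  imports Defs
begin

text \<open>The second moment of the partition function need not stay bounded, so uniform integrability is
  obtained by tilting. Averaging over the finitely many values \<open>S\<close> of \<open>\<tau> \<inter> {1..N}\<close>, the partition
  function is a mixture \<open>Z = \<Sum>\<^sub>S w\<^sub>S W\<^sub>S\<close> of Wick exponentials with \<open>E[W\<^sub>S] = 1\<close> and
  \<open>E[W\<^sub>S W\<^bsub>S'\<^esub>] = exp (\<beta>\<^sup>2 \<gamma>(S, S'))\<close>. Bounding \<open>1\<^bsub>{Z > K}\<^esub>\<close> by \<open>min 1 (Z / K)\<close> under each tilted measure gives
  \<open>E[Z; Z > K] \<le> \<Sum>\<^sub>S w\<^sub>S min 1 (G(S) / K)\<close> with \<open>G(S) = \<Sum>\<^bsub>S'\<^esub> w\<^bsub>S'\<^esub> exp (\<beta>\<^sup>2 \<gamma>(S, S'))\<close>.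
  It remains to see that \<open>G\<close> is tight. Given \<open>S\<close>, the exponent is at most \<open>|S'|\<close> times
  \<open>\<beta>\<^sup>2\<close> times the largest potential \<open>\<Sum>\<^bsub>m\<in>S\<^esub> |n - m|\<^bsup>2H-2\<^esup>\<close>, \<open>n \<le> N\<close>; the normalised number of points
  \<open>|S'|\<close> has all exponential moments, uniformly in \<open>N\<close>, and the normalised potential is tight: on a
  dyadic scale \<open>l = 2\<^sup>j\<close> no interval of length \<open>l\<close> contains many more than \<open>(N/l)\<^sup>\<epsilon> / b(l)\<close> points, and
  \<open>\<alpha> + 2H > 2\<close> makes the sum over scales converge. All estimates are in terms of
  \<open>b(n) = E[min(\<tau>\<^sub>1, n)] / n\<close>, to which the three scalings reduce at once: \<open>h\<^sub>N\<close> is of order at most \<open>b(N)\<close>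
  and \<open>\<beta>\<^sub>N\<close> of order at most \<open>b(N) N\<^bsup>1-H\<^esup>\<close>.\<close>

section \<open>Slow variation and regular tails\<close>

text \<open>The exceptional sets \<open>{v \<in> [0,2]. |f(x + v) - f(x)| \<ge> \<epsilon>/2}\<close> have small measure by dominated convergence,
  so those of \<open>x\<close> and \<open>x + u\<close> cannot cover the common interval \<open>[x + 1, x + 2]\<close>.\<close>

lemma slowly_varying_uniform:
  assumes sv: "slowly_varying L" and \<epsilon>: "\<epsilon> > 0"
  shows "\<forall>\<^sub>F x in at_top. \<forall>u\<in>{1..2}. \<bar>ln (L (u * x)) - ln (L x)\<bar> < \<epsilon>"
proof -
  \<comment> \<open>In the logarithmic variable dilations become translations, under which Lebesgue
    measure is invariant.\<close>
  define f where "f y = ln (L (exp y))" for y :: real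
  have pos: "L t > 0" if "t > 0" for t
    using sv that unfolding slowly_varying_def by blast
  have "L \<in> borel_measurable (restrict_space borel {0<..})"
    using sv unfolding slowly_varying_def by blast
  moreover have "exp \<in> borel \<rightarrow>\<^sub>M restrict_space borel {0::real<..}"
    by (rule measurable_restrict_space2) auto
  ultimately have "(\<lambda>y. L (exp y)) \<in> borel_measurable borel"
    by (rule measurable_compose[rotated])
  then have f_meas [measurable]: "f \<in> borel_measurable borel"
    unfolding f_def by measurable
  have f_lim: "((\<lambda>x. f (x + u) - f x) \<longlongrightarrow> 0) at_top" for u
  proof -
    have "((\<lambda>t. L (exp u * t) / L t) \<longlongrightarrow> 1) at_top"
      using sv unfolding slowly_varying_def by (meson exp_gt_zero)
    then have "((\<lambda>x. L (exp u * exp x) / L (exp x)) \<longlongrightarrow> 1) at_top"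
      by (rule filterlim_compose[OF _ exp_at_top])
    then have "((\<lambda>x. ln (L (exp u * exp x) / L (exp x))) \<longlongrightarrow> ln 1) at_top"
      by (rule tendsto_ln) simp
    then show ?thesis
      by (simp add: f_def ln_div pos exp_add less_imp_neq[symmetric] mult.commute)
  qed
  define E where "E x u = (if 0 \<le> u \<and> u \<le> 2 \<and> \<bar>f (x + u) - f x\<bar> \<ge> \<epsilon> / 2 then 1 else 0 :: real)" for x u
  have E_meas [measurable]: "E x \<in> borel_measurable lborel" for x
    unfolding E_def by measurable
  have E_bd: "norm (E x u) \<le> indicator {0..2} u" for x u
    by (simp add: E_def indicator_def)
  have ind_int: "integrable lborel (indicator {0..2::real} :: real \<Rightarrow> real)"
    by (simp add: integrable_real_indicator)
  have E_int: "integrable lborel (E x)" for x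
    by (rule Bochner_Integration.integrable_bound[OF ind_int]) (use E_bd in \<open>auto simp: indicator_def\<close>)
  have "((\<lambda>x. integral\<^sup>L lborel (E x)) \<longlongrightarrow> integral\<^sup>L lborel (\<lambda>_::real. 0 :: real)) at_top"
  proof (rule integral_dominated_convergence_at_top[where w = "indicator {0..2}"])
    have "((\<lambda>x. E x u) \<longlongrightarrow> 0) at_top" for u
    proof (rule tendsto_eventually)
      have "\<forall>\<^sub>F x in at_top. \<bar>f (x + u) - f x\<bar> < \<epsilon> / 2"
        using tendstoD[OF f_lim[of u], of "\<epsilon> / 2"] \<epsilon> by (simp add: dist_real_def)
      then show "\<forall>\<^sub>F x in at_top. E x u = 0"
        by eventually_elim (simp add: E_def)
    qed
    then show "AE u in lborel. ((\<lambda>x. E x u) \<longlongrightarrow> 0) at_top" by simp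
    show "\<forall>\<^sub>F x in at_top. AE u in lborel. norm (E x u) \<le> indicator {0..2} u"
      using E_bd by simp
  qed (auto simp: ind_int)
  then have "\<forall>\<^sub>F x in at_top. integral\<^sup>L lborel (E x) < 1 / 2"
    by (rule order_tendstoD(2)) simp
  then obtain X where X: "\<And>x. x \<ge> X \<Longrightarrow> integral\<^sup>L lborel (E x) < 1 / 2"
    by (auto simp: eventually_at_top_linorder)
  have unif: "\<bar>f (x + u) - f x\<bar> < \<epsilon>" if "x \<ge> X" "0 \<le> u" "u \<le> 1" for x u
  proof (rule ccontr)
    assume big: "\<not> \<bar>f (x + u) - f x\<bar> < \<epsilon>"
    have sh: "integrable lborel (\<lambda>v. E (x + u) (- u + 1 * v))"
      by (rule lborel_integrable_real_affine[OF E_int]) simp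
    have shi: "integral\<^sup>L lborel (\<lambda>v. E (x + u) (- u + 1 * v)) = integral\<^sup>L lborel (E (x + u))"
      using lborel_integral_real_affine[of 1 "E (x + u)" "- u"] by simp
    have "indicator {1..2} v \<le> E x v + E (x + u) (- u + 1 * v)" for v :: real
    proof (cases "v \<in> {1..2}")
      case True
      have "\<bar>f (x + v) - f x\<bar> \<ge> \<epsilon> / 2 \<or> \<bar>f (x + v) - f (x + u)\<bar> \<ge> \<epsilon> / 2"
        using big by linarith
      moreover have "x + u + (- u + v) = x + v" by simp
      ultimately show ?thesis
        using True that unfolding E_def by auto
    qed (simp add: E_def)
    then have "integral\<^sup>L lborel (indicator {1..2::real}) \<le> (\<integral>v. E x v + E (x + u) (- u + 1 * v) \<partial>lborel)"
      by (intro integral_mono Bochner_Integration.integrable_add E_int sh) (auto intro!: integrable_real_indicator)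
    also have "\<dots> = integral\<^sup>L lborel (E x) + integral\<^sup>L lborel (E (x + u))"
      by (subst Bochner_Integration.integral_add[OF E_int sh]) (simp only: shi)
    also have "\<dots> < 1"
      using X[of x] X[of "x + u"] that by linarith
    finally show False by simp
  qed
  have "\<forall>\<^sub>F x in at_top. x \<ge> exp X" by (rule eventually_ge_at_top)
  then show ?thesis
  proof eventually_elim
    case (elim x)
    have "\<bar>ln (L (u * x)) - ln (L x)\<bar> < \<epsilon>" if u: "u \<in> {1..2}" for u
    proof -
      have x0: "x > 0" using elim exp_gt_zero[of X] by linarith
      have "ln x \<ge> X" using elim x0 by (simp add: ln_ge_iff)
      moreover have "0 \<le> ln u" "ln u \<le> 1"
        using u ln_le_minus_one[of u] by auto
      ultimately show ?thesis
        using unif[of "ln x" "ln u"] u x0 by (simp add: f_def exp_add mult.commute)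
    qed
    then show ?case by blast
  qed
qed

lemma slowly_varying_pos: "slowly_varying L \<Longrightarrow> t > 0 \<Longrightarrow> L t > 0"
  unfolding slowly_varying_def by blast

lemma slowly_varying_le_exp:
  assumes sv: "slowly_varying L" and \<epsilon>: "\<epsilon> > 0"
  shows "\<forall>\<^sub>F x in at_top. \<forall>y\<in>{x..2*x}. L y \<le> exp \<epsilon> * L x"
  using slowly_varying_uniform[OF sv \<epsilon>] eventually_gt_at_top[of 0]
proof eventually_elim
  case (elim x)
  have "L y \<le> exp \<epsilon> * L x" if "y \<in> {x..2*x}" for y
  proof -
    have "y / x \<in> {1..2}" using that elim(2) by (auto simp: divide_simps)
    then have "\<bar>ln (L (y / x * x)) - ln (L x)\<bar> < \<epsilon>" using elim(1) by blast
    then have "ln (L y) \<le> \<epsilon> + ln (L x)" using elim(2) by (simp add: abs_less_iff)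
    moreover have "L y > 0" "L x > 0"
      using that elim(2) by (auto intro!: slowly_varying_pos[OF sv])
    ultimately show ?thesis
      by (metis exp_add exp_ln exp_le_cancel_iff)
  qed
  then show ?case by blast
qed

text \<open>Both indices are close to twice \<open>k\<close>, so each term is about
  \<open>2 powr (- 1 - \<alpha>) * p k\<close>; two of them give the factor
  \<open>2 powr - \<alpha>\<close>, and the larger \<open>\<rho>\<close> absorbs the error.\<close>

lemma regular_tail_pair:
  fixes p :: "nat \<Rightarrow> real"
  assumes sv: "slowly_varying L"
    and p: "\<And>n. n \<ge> 1 \<Longrightarrow> p n = L (real n) / real n powr (1 + \<alpha>)"
    and \<alpha>: "\<alpha> > 0" and \<rho>: "\<rho> > 2 powr - \<alpha>"
  shows "\<forall>\<^sub>F k in sequentially. p (2 * k) + p (2 * k - 1) \<le> \<rho> * p k"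
proof -
  \<comment> \<open>A single \<open>\<epsilon>\<close> controls both errors:
    \<open>exp \<epsilon>\<close> comes from \<open>L\<close>, and \<open>2 - \<epsilon>\<close>
    from \<open>2 * k - 1 \<ge> (2 - \<epsilon>) * k\<close>, valid once
    \<open>k \<ge> 1 / \<epsilon>\<close>.\<close>
  have "((\<lambda>\<epsilon>. 2 * exp \<epsilon> * (2 - \<epsilon>) powr (- 1 - \<alpha>)) \<longlongrightarrow> 2 * exp 0 * (2 - 0) powr (- 1 - \<alpha>)) (at_right 0)"
    by (intro tendsto_intros) auto
  moreover have "2 * exp 0 * (2 - 0) powr (- 1 - \<alpha>) < \<rho>"
    using \<rho> by (simp add: powr_diff powr_minus field_simps)
  ultimately have "\<forall>\<^sub>F \<epsilon> in at_right 0. 2 * exp \<epsilon> * (2 - \<epsilon>) powr (- 1 - \<alpha>) < \<rho>"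
    by (rule order_tendstoD(2))
  moreover have "\<forall>\<^sub>F \<epsilon> in at_right (0::real). \<epsilon> \<in> {0<..<1}"
    by (rule eventually_at_right_real) simp
  ultimately have "\<forall>\<^sub>F \<epsilon> in at_right 0. \<epsilon> \<in> {0<..<1} \<and> 2 * exp \<epsilon> * (2 - \<epsilon>) powr (- 1 - \<alpha>) < \<rho>"
    by eventually_elim simp
  then obtain \<epsilon> where \<epsilon>: "0 < \<epsilon>" "\<epsilon> < 1" "2 * exp \<epsilon> * (2 - \<epsilon>) powr (- 1 - \<alpha>) < \<rho>"
    using eventually_happens'[OF trivial_limit_at_right_real] by (metis (no_types, lifting) greaterThanLessThan_iff)
  have "\<forall>\<^sub>F k in sequentially. \<forall>y\<in>{real k..2 * real k}. L y \<le> exp \<epsilon> * L (real k)"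
    using slowly_varying_le_exp[OF sv \<epsilon>(1)] filterlim_real_sequentially
    by (rule eventually_compose_filterlim)
  moreover have "\<forall>\<^sub>F k in sequentially. real k \<ge> 1 / \<epsilon>"
    using filterlim_real_sequentially by (auto simp: filterlim_at_top)
  moreover have "\<forall>\<^sub>F k in sequentially. k \<ge> (1::nat)" by (rule eventually_ge_at_top)
  ultimately show ?thesis
  proof eventually_elim
    case (elim k)
    have Lk: "L (real k) > 0" using elim(3) by (intro slowly_varying_pos[OF sv]) simp
    have *: "p j \<le> exp \<epsilon> * (2 - \<epsilon>) powr (- 1 - \<alpha>) * p k" if j: "k \<le> j" "j \<le> 2 * k" "2 * k - 1 \<le> j" for j
    proof -
      have "(2 - \<epsilon>) * real k \<le> real (2 * k - 1)"
        using elim(2,3) \<epsilon> by (simp add: of_nat_diff field_simps)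
      also have "\<dots> \<le> real j" using j by linarith
      finally have "real j powr (- 1 - \<alpha>) \<le> ((2 - \<epsilon>) * real k) powr (- 1 - \<alpha>)"
        using \<alpha> \<epsilon> elim(3) by (intro powr_mono2') auto
      also have "\<dots> = (2 - \<epsilon>) powr (- 1 - \<alpha>) * real k powr (- 1 - \<alpha>)"
        using \<epsilon> by (simp add: powr_mult)
      finally have 1: "real j powr (- 1 - \<alpha>) \<le> (2 - \<epsilon>) powr (- 1 - \<alpha>) * real k powr (- 1 - \<alpha>)" .
      have 2: "L (real j) \<le> exp \<epsilon> * L (real k)"
        using elim(1) j by (simp add: atLeastAtMost_iff)
      have pw: "p i = L (real i) * real i powr (- 1 - \<alpha>)" if "i \<ge> 1" for i
        using p[OF that] powr_minus_divide[of "real i" "1 + \<alpha>"] by (simp add: algebra_simps)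
      have "p j = L (real j) * real j powr (- 1 - \<alpha>)" using pw j elim(3) by simp
      also have "\<dots> \<le> (exp \<epsilon> * L (real k)) * ((2 - \<epsilon>) powr (- 1 - \<alpha>) * real k powr (- 1 - \<alpha>))"
        using 1 2 Lk by (intro mult_mono) auto
      finally show ?thesis using pw[OF elim(3)] by (simp add: mult_ac)
    qed
    have pk: "p k \<ge> 0" using p[OF elim(3)] Lk by simp
    have "k \<le> 2 * k - 1" using elim(3) by linarith
    then have "p (2 * k) + p (2 * k - 1) \<le> (2 * exp \<epsilon> * (2 - \<epsilon>) powr (- 1 - \<alpha>)) * p k"
      using *[of "2 * k"] *[of "2 * k - 1"] elim(3) by simp
    also have "\<dots> \<le> \<rho> * p k" using \<epsilon>(3) pk by (intro mult_right_mono) auto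
    finally show ?case .
  qed
qed

text \<open>\<open>F (2 * j)\<close> is the sum of \<open>p\<close> beyond \<open>2 * j\<close>,
  whose indices split into the pairs \<open>2 * k - 1\<close>, \<open>2 * k\<close> with
  \<open>k > j\<close>; each pair is compared with \<open>p k\<close>.\<close>

lemma regular_tail_halving:
  fixes p F :: "nat \<Rightarrow> real"
  assumes sv: "slowly_varying L"
    and p: "\<And>n. n \<ge> 1 \<Longrightarrow> p n = L (real n) / real n powr (1 + \<alpha>)"
    and \<alpha>: "\<alpha> > 0" and \<rho>: "\<rho> > 2 powr - \<alpha>"
    and F: "\<And>k. F k - F (Suc k) = p (Suc k)" "F \<longlonglongrightarrow> 0"
  shows "\<forall>\<^sub>F j in sequentially. F (2 * j) \<le> \<rho> * F j"
proof -
  obtain K where K: "\<And>k. k \<ge> K \<Longrightarrow> p (2 * k) + p (2 * k - 1) \<le> \<rho> * p k"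
    using regular_tail_pair[OF sv p \<alpha> \<rho>] by (auto simp: eventually_sequentially)
  have "F (2 * j) \<le> \<rho> * F j" if "j \<ge> K" for j
  proof -
    \<comment> \<open>The increments of \<open>F\<close> telescope over finitely many pairs; letting
      \<open>i\<close> tend to infinity removes the far ends.\<close>
    have step: "F (2 * j) - F (2 * (j + i)) \<le> \<rho> * (F j - F (j + i))" for i
    proof (induction i)
      case (Suc i)
      have "p (2 * Suc (j + i)) + p (2 * Suc (j + i) - 1) \<le> \<rho> * p (Suc (j + i))"
        by (rule K) (use that in simp)
      moreover have "F (2 * (j + i)) - F (2 * (j + Suc i)) = p (2 * Suc (j + i)) + p (2 * Suc (j + i) - 1)"
        using F(1)[of "2 * (j + i)"] F(1)[of "Suc (2 * (j + i))"] by simp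
      moreover have "F (j + i) - F (j + Suc i) = p (Suc (j + i))"
        using F(1)[of "j + i"] by simp
      ultimately show ?case using Suc by (simp add: algebra_simps)
    qed simp
    have "filterlim (\<lambda>i. 2 * (j + i)) sequentially sequentially"
      by (rule filterlim_subseq) (auto simp: strict_mono_def)
    then have l1: "(\<lambda>i. F (2 * (j + i))) \<longlonglongrightarrow> 0"
      by (rule filterlim_compose[OF F(2)])
    have l2: "(\<lambda>i. F (j + i)) \<longlonglongrightarrow> 0"
      using LIMSEQ_ignore_initial_segment[OF F(2), of j] by (simp add: add.commute)
    have "(\<lambda>i. F (2 * j) - F (2 * (j + i))) \<longlonglongrightarrow> F (2 * j) - 0"
      "(\<lambda>i. \<rho> * (F j - F (j + i))) \<longlonglongrightarrow> \<rho> * (F j - 0)"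
      by (intro tendsto_intros l1 l2)+
    then have "F (2 * j) - 0 \<le> \<rho> * (F j - 0)"
      by (rule LIMSEQ_le) (use step in blast)
    then show ?thesis by simp
  qed
  then show ?thesis by (auto simp: eventually_sequentially)
qed

text \<open>For the tail \<open>F\<close> of \<open>\<tau>\<^sub>1\<close> this is \<open>E[min(\<tau>\<^sub>1, n)]\<close>.\<close>

definition truncated_mean :: "(nat \<Rightarrow> real) \<Rightarrow> nat \<Rightarrow> real" where
  "truncated_mean F n = (\<Sum>k<n. F k)"

section \<open>Growth of the truncated mean under doubling\<close>

locale tail =
  fixes F :: "nat \<Rightarrow> real"
  assumes anti: "\<And>k l. k \<le> l \<Longrightarrow> F l \<le> F k"
    and nonneg: "\<And>k. 0 \<le> F k" and F0: "F 0 = 1"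
begin

abbreviation "m \<equiv> truncated_mean F"

lemma le_one: "F k \<le> 1"
  using anti[of 0 k] F0 by simp

lemma m_mono: "k \<le> l \<Longrightarrow> m k \<le> m l"
  unfolding truncated_mean_def by (rule sum_mono2) (auto simp: nonneg)

lemma m_ge_1: "n \<ge> 1 \<Longrightarrow> m n \<ge> 1"
  using m_mono[of 1 n] F0 by (simp add: truncated_mean_def)

lemma m_le: "m n \<le> real n"
  using sum_mono[of "{..<n}" F "\<lambda>_. 1"] le_one by (simp add: truncated_mean_def)

lemma m_double_le: "m (2 * n) \<le> (\<Sum>k<n. 2 * F (2 * k))"
proof (induction n)
  case (Suc n)
  have "m (2 * Suc n) = m (2 * n) + F (2 * n) + F (2 * n + 1)"
    by (simp add: truncated_mean_def)
  then show ?case using Suc anti[of "2 * n" "2 * n + 1"] by simp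
qed (simp add: truncated_mean_def)

lemma m_double: "m (2 * n) \<le> 2 * m n"
proof -
  have "m (2 * n) \<le> (\<Sum>k<n. 2 * F (2 * k))" by (rule m_double_le)
  also have "\<dots> \<le> (\<Sum>k<n. 2 * F k)" by (intro sum_mono) (simp add: anti)
  finally show ?thesis by (simp add: truncated_mean_def sum_distrib_left)
qed

text \<open>The halving estimate is available only from \<open>j0\<close> on; the at most
  \<open>j0\<close> earlier terms cost 2 each because \<open>F\<close> is at most 1.\<close>

lemma m_double_halving:
  assumes "\<And>j. j \<ge> j0 \<Longrightarrow> F (2 * j) \<le> \<rho> * F j" and "\<rho> \<ge> 0"
  shows "m (2 * n) \<le> 2 * real j0 + 2 * \<rho> * m n"
proof -
  have "m (2 * n) \<le> (\<Sum>k<n. 2 * F (2 * k))" by (rule m_double_le)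
  also have "\<dots> \<le> (\<Sum>k<n. (if k < j0 then 2 else 0) + 2 * \<rho> * F k)"
  proof (intro sum_mono)
    fix k
    show "2 * F (2 * k) \<le> (if k < j0 then 2 else 0) + 2 * \<rho> * F k"
      using assms(1)[of k] le_one[of "2 * k"] mult_nonneg_nonneg[OF assms(2) nonneg[of k]]
      by (cases "k < j0") (auto simp: mult.assoc)
  qed
  also have "\<dots> = (\<Sum>k<n. if k < j0 then 2 else 0) + 2 * \<rho> * m n"
    by (simp add: sum.distrib truncated_mean_def sum_distrib_left)
  also have "(\<Sum>k<n. if k < j0 then 2 else (0::real)) = (\<Sum>k\<in>{..<n} \<inter> {..<j0}. 2)"
    by (simp add: sum.If_cases lessThan_def)
  also have "\<dots> \<le> 2 * real j0"
    using card_mono[of "{..<j0}" "{..<n} \<inter> {..<j0}"] by simp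
  finally show ?thesis by simp
qed

text \<open>Since \<open>m n \<le> m (2 * n)\<close>, the doubling estimate with
  \<open>2 * \<rho> < 1\<close> can be solved for \<open>m n\<close>. It yields a finite mean when
  \<alpha> > 1.\<close>

lemma m_bounded:
  assumes "\<forall>\<^sub>F j in sequentially. F (2 * j) \<le> \<rho> * F j" and "0 \<le> \<rho>" "\<rho> < 1 / 2"
  obtains B where "\<And>n. m n \<le> B"
proof -
  obtain j0 where j0: "\<And>j. j \<ge> j0 \<Longrightarrow> F (2 * j) \<le> \<rho> * F j"
    using assms(1) by (auto simp: eventually_sequentially)
  have d: "m (2 * n) \<le> 2 * real j0 + 2 * \<rho> * m n" for n
    by (rule m_double_halving[OF j0 assms(2)])
  have "m n \<le> 2 * real j0 / (1 - 2 * \<rho>)" for n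
    using d[of n] m_mono[of n "2 * n"] assms by (simp add: field_simps)
  then show thesis by (rule that)
qed

text \<open>A one-sided Potter bound. Each doubling of the argument costs the factor
  \<open>2 * \<rho>\<close>, which is below \<open>2 powr \<kappa>\<close>; the additive error of
  the doubling estimate is harmless once \<open>m\<close> is large, and for bounded \<open>m\<close>
  the claim is immediate from \<open>m n \<ge> 1\<close>.\<close>

lemma m_regular:
  assumes h: "\<forall>\<^sub>F j in sequentially. F (2 * j) \<le> \<rho> * F j"
    and \<rho>: "0 \<le> \<rho>" "2 * \<rho> < 2 powr \<kappa>" and \<kappa>: "\<kappa> \<ge> 0"
  obtains C where "C \<ge> 1" "\<And>n N. 1 \<le> n \<Longrightarrow> n \<le> N \<Longrightarrow> m N \<le> C * (real N / real n) powr \<kappa> * m n"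
proof (cases "\<exists>B. \<forall>n. m n \<le> B")
  case True
  then obtain B where B: "\<And>n. m n \<le> B" by blast
  have "m N \<le> max 1 B * (real N / real n) powr \<kappa> * m n" if "1 \<le> n" "n \<le> N" for n N
  proof -
    have "m N \<le> max 1 B" using B by (simp add: le_max_iff_disj)
    also have "\<dots> = max 1 B * 1 * 1" by simp
    also have "\<dots> \<le> max 1 B * (real N / real n) powr \<kappa> * m n"
      using that m_ge_1[of n] \<kappa> by (intro mult_mono ge_one_powr_ge_zero) auto
    finally show ?thesis .
  qed
  then show thesis by (intro that[of "max 1 B"]) auto
next
  case False
  obtain j0 where j0: "\<And>j. j \<ge> j0 \<Longrightarrow> F (2 * j) \<le> \<rho> * F j"
    using h by (auto simp: eventually_sequentially)
  have d: "m (2 * n) \<le> 2 * real j0 + 2 * \<rho> * m n" for n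
    by (rule m_double_halving[OF j0 \<rho>(1)])
  \<comment> \<open>Beyond this value of \<open>m\<close> the gap
    \<open>2 powr \<kappa> - 2 * \<rho>\<close> absorbs the constant \<open>2 * j0\<close>.\<close>
  obtain n0' where n0': "m n0' > 2 * real j0 / (2 powr \<kappa> - 2 * \<rho>)"
    using False by (auto simp: not_le)
  define n0 where "n0 = max 1 n0'"
  have n0: "n0 \<ge> 1" by (simp add: n0_def)
  have dbl: "m (2 * n) \<le> 2 powr \<kappa> * m n" if "n \<ge> n0" for n
  proof -
    have "m n \<ge> m n0'" using that by (intro m_mono) (simp add: n0_def)
    then have "m n > 2 * real j0 / (2 powr \<kappa> - 2 * \<rho>)" using n0' by linarith
    then have "m n * (2 powr \<kappa> - 2 * \<rho>) > 2 * real j0" using \<rho> by (simp add: field_simps)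
    then show ?thesis using d[of n] by (simp add: algebra_simps)
  qed
  \<comment> \<open>The smaller argument is doubled until it exceeds \<open>N / 2\<close>; the extra
    factor 2 pays for the last incomplete doubling.\<close>
  have big: "m N \<le> 2 * (real N / real n) powr \<kappa> * m n" if "n0 \<le> n" "n \<le> N" for n N
    using that
  proof (induction "N - n" arbitrary: n rule: less_induct)
    case less
    have n1: "n \<ge> 1" using n0 less.prems by linarith
    show ?case
    proof (cases "N < 2 * n")
      case True
      have "m N \<le> m (2 * n)" using True by (intro m_mono) simp
      also have "\<dots> \<le> 2 * 1 * m n" using m_double by simp
      also have "\<dots> \<le> 2 * (real N / real n) powr \<kappa> * m n"
        using less.prems n1 m_ge_1[of n] \<kappa> by (intro mult_mono ge_one_powr_ge_zero) auto
      finally show ?thesis .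
    next
      case False
      have "m N \<le> 2 * (real N / real (2 * n)) powr \<kappa> * m (2 * n)"
        using False less.prems n1 by (intro less.hyps) auto
      also have "\<dots> \<le> 2 * (real N / real (2 * n)) powr \<kappa> * (2 powr \<kappa> * m n)"
        using dbl less.prems by (intro mult_left_mono) auto
      also have "\<dots> = 2 * (real N / real n) powr \<kappa> * m n"
        using n1 by (simp add: powr_divide powr_mult)
      finally show ?thesis .
    qed
  qed
  \<comment> \<open>Arguments below \<open>n0\<close> are compared with \<open>n0\<close> at the
    price of a factor \<open>n0\<close>, since \<open>m n0 \<le> n0\<close> and
    \<open>m n \<ge> 1\<close>.\<close>
  have "m N \<le> 2 * real n0 * (real N / real n) powr \<kappa> * m n" if n: "1 \<le> n" "n \<le> N" for n N
  proof -
    have q: "(real N / real n) powr \<kappa> \<ge> 1"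
      using n \<kappa> by (intro ge_one_powr_ge_zero) auto
    consider "n \<ge> n0" | "n < n0" "n0 \<le> N" | "N < n0" by linarith
    then show ?thesis
    proof cases
      case 1
      have "m N \<le> 2 * 1 * (real N / real n) powr \<kappa> * m n" using big[OF 1 n(2)] by simp
      also have "\<dots> \<le> 2 * real n0 * (real N / real n) powr \<kappa> * m n"
        using n0 m_ge_1[OF n(1)] by (intro mult_right_mono mult_left_mono) auto
      finally show ?thesis .
    next
      case 2
      have "m N \<le> 2 * (real N / real n0) powr \<kappa> * m n0" using big[OF _ 2(2)] by simp
      also have "\<dots> \<le> 2 * (real N / real n) powr \<kappa> * (real n0 * m n)"
      proof (intro mult_mono mult_left_mono powr_mono2)
        show "m n0 \<le> real n0 * m n"
          using m_le[of n0] m_ge_1[OF n(1)] mult_left_mono[of 1 "m n" "real n0"] by simp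
        show "real N / real n0 \<le> real N / real n"
          using 2 n by (intro divide_left_mono) auto
      qed (use \<kappa> n0 m_ge_1[of n0] in auto)
      finally show ?thesis by (simp add: mult_ac)
    next
      case 3
      have "m N \<le> real n0 * 1 * 1" using m_le[of N] 3 by simp
      also have "\<dots> \<le> (2 * real n0) * (real N / real n) powr \<kappa> * m n"
        using q m_ge_1[OF n(1)] by (intro mult_mono) auto
      finally show ?thesis .
    qed
  qed
  then show thesis using n0 by (intro that[of "2 * real n0"]) auto
qed

end

section \<open>Renewal processes\<close>

lemma exp_minus_le_half:
  fixes x :: real
  assumes "0 \<le> x" "x \<le> 1"
  shows "exp (- x) \<le> 1 - x / 2"
proof -
  have "1 + x \<le> exp x" by (rule exp_ge_add_one_self)
  then have "exp (- x) \<le> 1 / (1 + x)"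
    using assms by (simp add: exp_minus inverse_eq_divide frac_le)
  also have "\<dots> \<le> 1 - x / 2"
  proof -
    have "x * x \<le> x * 1" using assms by (intro mult_left_mono) auto
    then show ?thesis using assms by (simp add: field_simps)
  qed
  finally show ?thesis .
qed

text \<open>The Laplace weight of parameter 1/n. The value 0 at infinity keeps it multiplicative
  over sums with infinite increments.\<close>

definition damp :: "nat \<Rightarrow> enat \<Rightarrow> real" where
  "damp n e = (case e of enat j \<Rightarrow> exp (- (real j / real n)) | \<infinity> \<Rightarrow> 0)"

lemma damp_nonneg: "0 \<le> damp n e"
  by (simp add: damp_def split: enat.split)

lemma damp_le_one: "damp n e \<le> 1"
  by (simp add: damp_def split: enat.split)

lemma damp_add: "damp n (d + e) = damp n d * damp n e"
  by (cases d; cases e) (simp_all add: damp_def add_divide_distrib mult_exp_exp)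

lemma damp_sum: "finite J \<Longrightarrow> damp n (\<Sum>j\<in>J. e j) = (\<Prod>j\<in>J. damp n (e j))"
  by (induction J rule: finite_induct) (simp_all add: damp_add, simp add: damp_def zero_enat_def)

lemma sum_indicator_less_enat:
  "(\<Sum>k<n. indicator {e. enat k < e} (enat j) :: real) = real (min j n)"
proof -
  have "(\<Sum>k<n. indicator {e. enat k < e} (enat j) :: real) = (\<Sum>k\<in>{..<n} \<inter> {..<j}. 1)"
    by (subst sum.inter_restrict) (auto intro!: sum.cong simp only: finite_lessThan indicator_def of_bool_def mem_Collect_eq enat_ord_simps lessThan_iff)
  also have "{..<n} \<inter> {..<j} = {..<min j n}" by auto
  finally show ?thesis by simp
qed

text \<open>The inequality exp(-x) \<le> 1 - x/2 on [0,1] is applied to x = min(e, n)/n. Writing the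
  minimum as a sum of tail indicators makes its mean a sum of tail probabilities.\<close>

lemma damp_le:
  assumes "n \<ge> 1"
  shows "damp n e \<le> 1 - (\<Sum>k<n. indicator {e. enat k < e} e) / (2 * real n)"
proof (cases e)
  case (enat j)
  have "damp n e \<le> exp (- (real (min j n) / real n))"
    by (auto simp: damp_def enat intro!: divide_right_mono)
  also have "\<dots> \<le> 1 - real (min j n) / real n / 2"
    using assms by (intro exp_minus_le_half) auto
  finally show ?thesis using sum_indicator_less_enat[of j n] by (simp add: enat)
next
  case infinity
  then show ?thesis using assms by (simp add: damp_def)
qed

lemma card_renewal_points_le:
  fixes t :: "nat \<Rightarrow> enat"
  assumes "mono t" and "enat b < t q" and "\<And>i. i < p \<Longrightarrow> t i < enat a"
  shows "card {n\<in>{a..b}. \<exists>i. t i = enat n} \<le> q - p"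
proof -
  have "{n\<in>{a..b}. \<exists>i. t i = enat n} \<subseteq> (\<lambda>i. the_enat (t i)) ` {p..<q}"
  proof safe
    fix n i assume n: "n \<in> {a..b}" and i: "t i = enat n"
    have "i < q"
    proof (rule ccontr)
      assume "\<not> i < q"
      then have "t q \<le> t i" using assms(1) by (simp add: monoD)
      then have "enat b < enat n" using assms(2) i by (metis less_le_trans)
      then show False using n by simp
    qed
    moreover have "p \<le> i"
    proof (rule ccontr)
      assume "\<not> p \<le> i"
      then have "enat n < enat a" using assms(3)[of i] i by simp
      then show False using n by simp
    qed
    ultimately show "n \<in> (\<lambda>i. the_enat (t i)) ` {p..<q}"
      by (intro image_eqI[of _ _ i]) (auto simp: i)
  qed
  then have "card {n\<in>{a..b}. \<exists>i. t i = enat n} \<le> card ((\<lambda>i. the_enat (t i)) ` {p..<q})"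
    by (intro card_mono) auto
  also have "\<dots> \<le> q - p" using card_image_le[of "{p..<q}"] by simp
  finally show ?thesis .
qed

text \<open>Among $2k$ consecutive indices there is a full block $ik, \dots, (i+1)k$ aligned to
  multiples of $k$. Working with aligned blocks keeps the union bound for short blocks small
  without recourse to the Markov property.\<close>

lemma aligned_block:
  fixes t :: "nat \<Rightarrow> enat"
  assumes t: "mono t" and k: "k \<ge> 1"
    and card: "card {n\<in>{a..b}. \<exists>i. t i = enat n} \<ge> 2 * k"
  obtains i where "enat a \<le> t (i * k)" "t (Suc i * k) \<le> enat b"
proof -
  define A where "A = {n\<in>{a..b}. \<exists>i. t i = enat n}"
  have "card A \<noteq> 0" using card k unfolding A_def by linarith
  then have "A \<noteq> {}" by auto
  then obtain n i0 where "n \<in> A" "t i0 = enat n" unfolding A_def by blast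
  then have i0: "enat a \<le> t i0" by (simp add: A_def)
  define p where "p = (LEAST i. enat a \<le> t i)"
  have p: "enat a \<le> t p" unfolding p_def by (rule LeastI[of _ i0]) (rule i0)
  have below: "t i < enat a" if "i < p" for i
    using not_less_Least[OF that[unfolded p_def]] by (simp add: not_le)
  have hi: "t (p + 2 * k - 1) \<le> enat b"
  proof (rule ccontr)
    assume "\<not> ?thesis"
    then have "card A \<le> p + 2 * k - 1 - p"
      unfolding A_def by (intro card_renewal_points_le[OF t _ below]) auto
    then show False using card k by (simp add: A_def)
  qed
  \<comment> \<open>This is \<open>p / k\<close> rounded up, the first aligned block not starting
    before \<open>p\<close>. At most \<open>k - 1\<close> indices are lost, so the block still ends
    by \<open>p + 2 * k - 1\<close>.\<close>
  define i where "i = (p + k - 1) div k"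
  have i: "p \<le> i * k" "i * k \<le> p + k - 1"
  proof -
    have eq: "p + k - 1 = i * k + (p + k - 1) mod k" by (simp add: i_def)
    moreover have "(p + k - 1) mod k < k" using k by simp
    ultimately show "p \<le> i * k" by linarith
    show "i * k \<le> p + k - 1" using eq by linarith
  qed
  have "enat a \<le> t (i * k)" using p monoD[OF t i(1)] by (rule order_trans)
  moreover have "t (Suc i * k) \<le> enat b"
  proof -
    have "Suc i * k \<le> p + 2 * k - 1" using i(2) k by simp
    from monoD[OF t this] hi show ?thesis by (rule order_trans)
  qed
  ultimately show thesis by (rule that)
qed

lemma measurable_enat_add [measurable]:
  fixes f g :: "'a \<Rightarrow> enat"
  assumes [measurable]: "f \<in> M \<rightarrow>\<^sub>M count_space UNIV" "g \<in> M \<rightarrow>\<^sub>M count_space UNIV"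
  shows "(\<lambda>x. f x + g x) \<in> M \<rightarrow>\<^sub>M count_space UNIV"
  by (rule measurable_compose_countable[where f = "\<lambda>i x. i + g x" and g = f]) measurable

lemma measurable_enat_sum [measurable (raw)]:
  fixes f :: "'i \<Rightarrow> 'a \<Rightarrow> enat"
  assumes "\<And>i. i \<in> J \<Longrightarrow> f i \<in> M \<rightarrow>\<^sub>M count_space UNIV"
  shows "(\<lambda>x. \<Sum>i\<in>J. f i x) \<in> M \<rightarrow>\<^sub>M count_space UNIV"
  using assms by (induction J rule: infinite_finite_induct) simp_all

section \<open>Renewal times and deviation bounds for sums of increments\<close>

locale renewal = prob_space M for M :: "'a measure" +
  fixes \<xi> :: "nat \<Rightarrow> 'a \<Rightarrow> enat"
  assumes indep: "indep_vars (\<lambda>_. count_space UNIV) \<xi> UNIV"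
    and ident: "distr M (count_space UNIV) (\<xi> i) = distr M (count_space UNIV) (\<xi> 0)"
    and ge1: "AE x in M. 1 \<le> \<xi> i x"
begin

definition T :: "nat \<Rightarrow> 'a \<Rightarrow> enat" where
  "T i x = (\<Sum>j<i. \<xi> j x)"

definition F :: "nat \<Rightarrow> real" where
  "F k = prob {x \<in> space M. enat k < \<xi> 0 x}"

lemma \<xi>_meas [measurable]: "\<xi> i \<in> M \<rightarrow>\<^sub>M count_space UNIV"
  using indep by (auto simp: indep_vars_def)

lemma T_meas [measurable]: "T i \<in> M \<rightarrow>\<^sub>M count_space UNIV"
  unfolding T_def by measurable

lemma mono_T: "mono (\<lambda>i. T i x)"
  by (intro monoI) (auto simp: T_def intro!: sum_mono2)

lemma T_split: "k \<le> l \<Longrightarrow> T l x = T k x + (\<Sum>j\<in>{k..<l}. \<xi> j x)"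
  unfolding T_def by (subst sum.union_disjoint[symmetric]) (auto intro!: sum.cong)

sublocale tail F
proof
  show "F l \<le> F k" if "k \<le> l" for k l
    unfolding F_def using that
    by (intro finite_measure_mono) (auto intro: le_less_trans[of _ "enat l"])
  show "0 \<le> F k" for k by (simp add: F_def)
  have "AE x in M. enat 0 < \<xi> 0 x"
    using ge1[of 0] by eventually_elim (auto simp: zero_enat_def[symmetric] i0_less)
  then show "F 0 = 1"
    unfolding F_def by (subst prob_Collect_eq_1) auto
qed

text \<open>The reciprocal of \<open>b n\<close> is the order of the number of renewals up to
  \<open>n\<close>.\<close>

definition b :: "nat \<Rightarrow> real" where
  "b n = m n / real n"

lemma expectation_ident:
  fixes g :: "enat \<Rightarrow> real"
  shows "expectation (\<lambda>x. g (\<xi> i x)) = expectation (\<lambda>x. g (\<xi> 0 x))"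
  using ident[of i] integral_distr[OF \<xi>_meas, of g]
  by (metis borel_measurable_count_space)

lemma expectation_damp:
  assumes n: "n \<ge> 1"
  shows "expectation (\<lambda>x. damp n (\<xi> i x)) \<le> 1 - b n / 2"
proof -
  have ind: "expectation (\<lambda>x. indicator {e. enat k < e} (\<xi> 0 x)) = F k" for k
  proof -
    have "expectation (\<lambda>x. indicator {e. enat k < e} (\<xi> 0 x)) =
        expectation (indicator {x \<in> space M. enat k < \<xi> 0 x})"
      by (intro Bochner_Integration.integral_cong) (auto simp: indicator_def)
    also have "\<dots> = F k" unfolding F_def by simp
    finally show ?thesis .
  qed
  have int: "integrable M (\<lambda>x. indicator {e. enat k < e} (\<xi> 0 x) :: real)" for k
    by (rule integrable_const_bound[of _ 1]) (auto simp: indicator_def)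
  have "expectation (\<lambda>x. damp n (\<xi> i x)) = expectation (\<lambda>x. damp n (\<xi> 0 x))"
    by (rule expectation_ident)
  also have "\<dots> \<le> expectation (\<lambda>x. 1 - (\<Sum>k<n. indicator {e. enat k < e} (\<xi> 0 x)) / (2 * real n))"
  proof (rule integral_mono)
    show "integrable M (\<lambda>x. damp n (\<xi> 0 x))"
      by (rule integrable_const_bound[of _ 1]) (auto simp: damp_nonneg damp_le_one)
    show "integrable M (\<lambda>x. 1 - (\<Sum>k<n. indicator {e. enat k < e} (\<xi> 0 x)) / (2 * real n))"
      using int by auto
  qed (use damp_le[OF n] in auto)
  also have "\<dots> = 1 - (\<Sum>k<n. F k) / (2 * real n)"
    using int by (simp add: ind prob_space)
  finally show ?thesis by (simp add: b_def truncated_mean_def)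
qed

text \<open>Exponential Markov inequality with the weight \<open>damp n\<close>: independence gives
  a product, and each factor is at most \<open>1 - b n / 2 \<le> exp (- b n / 2)\<close>. The scale
  \<open>n\<close> is kept separate from \<open>l\<close> so that it can be chosen later.\<close>

lemma chernoff:
  assumes n: "n \<ge> 1" and J: "finite J"
  shows "prob {x \<in> space M. (\<Sum>j\<in>J. \<xi> j x) \<le> enat l}
    \<le> exp (real l / real n - real (card J) * (b n / 2))"
proof -
  let ?b = "b n / 2"
  have "prob {x \<in> space M. (\<Sum>j\<in>J. \<xi> j x) \<le> enat l}
      = expectation (indicator {x \<in> space M. (\<Sum>j\<in>J. \<xi> j x) \<le> enat l})"
    by simp
  also have "\<dots> \<le> expectation (\<lambda>x. exp (real l / real n) * damp n (\<Sum>j\<in>J. \<xi> j x))"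
  proof (rule integral_mono)
    show "integrable M (\<lambda>x. exp (real l / real n) * damp n (\<Sum>j\<in>J. \<xi> j x))"
      by (intro integrable_mult_right integrable_const_bound[of _ 1])
         (auto simp: damp_nonneg damp_le_one)
    show "indicator {x \<in> space M. (\<Sum>j\<in>J. \<xi> j x) \<le> enat l} x
        \<le> exp (real l / real n) * damp n (\<Sum>j\<in>J. \<xi> j x)" if "x \<in> space M" for x
    proof (cases "(\<Sum>j\<in>J. \<xi> j x) \<le> enat l")
      case True
      then obtain i where i: "(\<Sum>j\<in>J. \<xi> j x) = enat i" "i \<le> l"
        by (metis enat_ile enat_ord_simps(1))
      have "1 \<le> exp (real l / real n + - (real i / real n))"
        using i by (simp add: divide_right_mono)
      also have "\<dots> = exp (real l / real n) * damp n (\<Sum>j\<in>J. \<xi> j x)"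
        by (simp only: i damp_def exp_add enat.case)
      finally show ?thesis using True that by simp
    qed (auto simp: damp_nonneg)
  qed (auto intro!: integrable_real_indicator simp: less_top[symmetric])
  also have "\<dots> = exp (real l / real n) * expectation (\<lambda>x. \<Prod>j\<in>J. damp n (\<xi> j x))"
    using J by (simp add: damp_sum)
  also have "expectation (\<lambda>x. \<Prod>j\<in>J. damp n (\<xi> j x)) = (\<Prod>j\<in>J. expectation (\<lambda>x. damp n (\<xi> j x)))"
  proof (cases "J = {}")
    case False
    show ?thesis
    proof (rule indep_vars_lebesgue_integral[OF J])
      show "indep_vars (\<lambda>_. borel) (\<lambda>j x. damp n (\<xi> j x)) J"
        by (rule indep_vars_compose2[OF indep_vars_subset[OF indep]]) auto
      show "integrable M (\<lambda>x. damp n (\<xi> i x))" for i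
        by (rule integrable_const_bound[of _ 1]) (auto simp: damp_nonneg damp_le_one)
    qed
  qed (simp add: prob_space)
  also have "\<dots> \<le> (\<Prod>j\<in>J. exp (- ?b))"
  proof (intro prod_mono conjI)
    fix j
    show "0 \<le> expectation (\<lambda>x. damp n (\<xi> j x))" by (simp add: damp_nonneg)
    have "expectation (\<lambda>x. damp n (\<xi> j x)) \<le> 1 - ?b" by (rule expectation_damp[OF n])
    also have "\<dots> \<le> exp (- ?b)" using exp_ge_add_one_self[of "- ?b"] by simp
    finally show "expectation (\<lambda>x. damp n (\<xi> j x)) \<le> exp (- ?b)" .
  qed
  also have "exp (real l / real n) * (\<Prod>j\<in>J. exp (- ?b)) = exp (real l / real n - real (card J) * ?b)"
    by (simp add: exp_of_nat_mult[symmetric] mult_exp_exp)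
  finally show ?thesis by simp
qed

end

section \<open>Exponential moments of the number of renewals\<close>

text \<open>The increment of \<open>exp (\<theta> * k)\<close> is at most
  \<open>\<theta> * exp (\<theta> * k)\<close>. This turns an exponential moment of a count into a
  weighted sum of tail events.\<close>

lemma exp_scaled_le:
  fixes \<theta> :: real
  assumes "0 \<le> \<theta>"
  shows "exp (\<theta> * real n) \<le> 1 + (\<Sum>k=1..n. \<theta> * exp (\<theta> * real k))"
proof (induction n)
  case (Suc n)
  have "1 - \<theta> \<le> exp (- \<theta>)" using exp_ge_add_one_self[of "- \<theta>"] by simp
  then have "exp (\<theta> * real (Suc n)) * (1 - \<theta>) \<le> exp (\<theta> * real (Suc n)) * exp (- \<theta>)"
    by (intro mult_left_mono) auto
  also have "\<dots> = exp (\<theta> * real n)" by (simp add: mult_exp_exp algebra_simps)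
  finally have "exp (\<theta> * real (Suc n)) \<le> exp (\<theta> * real n) + \<theta> * exp (\<theta> * real (Suc n))"
    by (simp add: algebra_simps)
  then show ?case using Suc by simp
qed simp

text \<open>By \<open>\<theta> \<le> exp \<theta> - 1\<close> each term is at most a difference of
  consecutive exponentials, so the sum stays below 1 uniformly in \<open>\<theta>\<close>.\<close>

lemma sum_exp_minus_le:
  fixes \<theta> :: real
  shows "(\<Sum>k=1..n. \<theta> * exp (- (\<theta> * real k))) \<le> 1 - exp (- (\<theta> * real n))"
proof (induction n)
  case (Suc n)
  have "1 + \<theta> \<le> exp \<theta>" by (rule exp_ge_add_one_self)
  then have "exp (- (\<theta> * real (Suc n))) * (1 + \<theta>) \<le> exp (- (\<theta> * real (Suc n))) * exp \<theta>"
    by (intro mult_left_mono) auto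
  also have "\<dots> = exp (- (\<theta> * real n))" by (simp add: mult_exp_exp algebra_simps)
  finally show ?case using Suc by (simp add: algebra_simps)
qed simp

lemma nat_ceiling_bounds:
  fixes y :: real
  assumes "y \<ge> 1"
  shows "1 \<le> nat \<lceil>y\<rceil>" "y \<le> real (nat \<lceil>y\<rceil>)" "real (nat \<lceil>y\<rceil>) \<le> y + 1" "real (nat \<lceil>y\<rceil>) \<le> 2 * y"
  using assms by linarith+

context renewal
begin

definition R :: "nat \<Rightarrow> 'a \<Rightarrow> nat set" where
  "R N x = renewal_set T x \<inter> {1..N}"

definition q :: "nat \<Rightarrow> nat set \<Rightarrow> real" where
  "q N S = prob {x \<in> space M. R N x = S}"

lemma R_eq: "R N x = {n\<in>{1..N}. \<exists>i. T i x = enat n}"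
  by (auto simp: R_def renewal_set_def)

lemma q_nonneg: "0 \<le> q N S"
  by (simp add: q_def)

lemma R_subset: "R N x \<subseteq> {1..N}"
  by (auto simp: R_def)

lemma card_R_le: "card (R N x) \<le> N"
  using card_mono[OF _ R_subset, of N x] by simp

lemma R_pred [measurable]: "Measurable.pred M (\<lambda>x. R N x = S)"
proof -
  have "(\<lambda>x. R N x = S) = (\<lambda>x. S \<subseteq> {1..N} \<and> (\<forall>n\<in>{1..N}. (n \<in> S) = (\<exists>i. T i x = enat n)))"
    unfolding R_eq by (intro ext) blast
  also have "Measurable.pred M \<dots>" by measurable
  finally show ?thesis .
qed

lemma R_meas [measurable]: "R N \<in> M \<rightarrow>\<^sub>M count_space (Pow {1..N})"
  by (rule measurable_count_space_eq2[THEN iffD2])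
     (use R_subset in \<open>auto simp: Int_def conj_commute vimage_def\<close>)

lemma integrable_R: "integrable M (\<lambda>x. \<phi> (R N x) :: real)"
proof (rule integrable_const_bound)
  show "AE x in M. norm (\<phi> (R N x)) \<le> (\<Sum>S\<in>Pow {1..N}. \<bar>\<phi> S\<bar>)"
  proof (rule AE_I2)
    fix x
    show "norm (\<phi> (R N x)) \<le> (\<Sum>S\<in>Pow {1..N}. \<bar>\<phi> S\<bar>)"
      using member_le_sum[of "R N x" "Pow {1..N}" "\<lambda>S. \<bar>\<phi> S\<bar>"] R_subset by simp
  qed
  show "(\<lambda>x. \<phi> (R N x)) \<in> borel_measurable M"
    by (rule measurable_compose[OF R_meas]) simp
qed

text \<open>The set \<open>R N x\<close> takes finitely many values, so averages over the renewal
  become finite sums; no interchange of integrals over the two probability spaces is then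
  involved.\<close>

lemma expectation_R:
  fixes \<phi> :: "nat set \<Rightarrow> real"
  shows "expectation (\<lambda>x. \<phi> (R N x)) = (\<Sum>S\<in>Pow {1..N}. q N S * \<phi> S)"
proof -
  have "expectation (\<lambda>x. \<phi> (R N x))
      = expectation (\<lambda>x. \<Sum>S\<in>Pow {1..N}. indicator {x\<in>space M. R N x = S} x * \<phi> S)"
  proof (rule Bochner_Integration.integral_cong[OF refl])
    fix x assume x: "x \<in> space M"
    have "(\<Sum>S\<in>Pow {1..N}. indicator {x\<in>space M. R N x = S} x * \<phi> S)
        = (\<Sum>S\<in>Pow {1..N}. if S = R N x then \<phi> S else 0)"
      using x by (intro sum.cong) (auto simp: indicator_def)
    also have "\<dots> = \<phi> (R N x)" using R_subset by (simp add: sum.delta)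
    finally show "\<phi> (R N x) = (\<Sum>S\<in>Pow {1..N}. indicator {x\<in>space M. R N x = S} x * \<phi> S)" by simp
  qed
  also have "\<dots> = (\<Sum>S\<in>Pow {1..N}. expectation (\<lambda>x. indicator {x\<in>space M. R N x = S} x * \<phi> S))"
    by (intro Bochner_Integration.integral_sum integrable_mult_left integrable_real_indicator)
       (auto simp: less_top[symmetric])
  also have "\<dots> = (\<Sum>S\<in>Pow {1..N}. q N S * \<phi> S)"
    by (intro sum.cong) (auto simp: q_def)
  finally show ?thesis .
qed

lemma sum_q: "(\<Sum>S\<in>Pow {1..N}. q N S) = 1"
  using expectation_R[of "\<lambda>_. 1" N] by (simp add: prob_space)

lemma T_le_if_card_R_ge:
  assumes "1 \<le> k" "k \<le> card (R N x)"
  shows "T k x \<le> enat N"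
proof (rule ccontr)
  assume "\<not> ?thesis"
  \<comment> \<open>The relevant indices start at 1, because \<open>T 0\<close> is 0 and lies
    outside \<open>{1..N}\<close>.\<close>
  then have "card (R N x) \<le> k - 1"
    unfolding R_eq using assms
    by (intro card_renewal_points_le[OF mono_T]) (auto simp: T_def zero_enat_def)
  then show False using assms by simp
qed

text \<open>At least \<open>k\<close> renewals up to \<open>N\<close> force
  \<open>T k \<le> N\<close>, which by \<open>chernoff\<close> has probability at most
  \<open>exp (N / n - 2 * \<theta> * k)\<close>. One factor \<open>exp (- \<theta> * k)\<close> pays
  for the exponential moment, the other is summable.\<close>

lemma exp_moment_R:
  assumes n: "n \<ge> 1" and \<theta>: "0 \<le> \<theta>" "\<theta> \<le> b n / 4"
  shows "(\<Sum>S\<in>Pow {1..N}. q N S * exp (\<theta> * real (card S))) \<le> 1 + exp (real N / real n)"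
proof -
  have "(\<Sum>S\<in>Pow {1..N}. q N S * exp (\<theta> * real (card S))) = expectation (\<lambda>x. exp (\<theta> * real (card (R N x))))"
    by (rule expectation_R[symmetric])
  also have "\<dots> \<le> expectation (\<lambda>x. 1 + (\<Sum>k=1..N. \<theta> * exp (\<theta> * real k) * indicator {x\<in>space M. T k x \<le> enat N} x))"
  proof (rule integral_mono[OF integrable_R])
    show "integrable M (\<lambda>x. 1 + (\<Sum>k=1..N. \<theta> * exp (\<theta> * real k) * indicator {x\<in>space M. T k x \<le> enat N} x))"
      by (intro Bochner_Integration.integrable_add Bochner_Integration.integrable_sum
            integrable_mult_right integrable_real_indicator) (auto simp: less_top[symmetric])
    fix x assume x: "x \<in> space M"
    have "exp (\<theta> * real (card (R N x))) \<le> 1 + (\<Sum>k=1..card (R N x). \<theta> * exp (\<theta> * real k))"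
      by (rule exp_scaled_le[OF \<theta>(1)])
    also have "(\<Sum>k=1..card (R N x). \<theta> * exp (\<theta> * real k))
        = (\<Sum>k=1..card (R N x). \<theta> * exp (\<theta> * real k) * indicator {x\<in>space M. T k x \<le> enat N} x)"
      using x T_le_if_card_R_ge by (intro sum.cong) auto
    also have "\<dots> \<le> (\<Sum>k=1..N. \<theta> * exp (\<theta> * real k) * indicator {x\<in>space M. T k x \<le> enat N} x)"
      using \<theta>(1) card_R_le by (intro sum_mono2) (auto intro: order_trans)
    finally show "exp (\<theta> * real (card (R N x)))
        \<le> 1 + (\<Sum>k=1..N. \<theta> * exp (\<theta> * real k) * indicator {x\<in>space M. T k x \<le> enat N} x)"
      by simp
  qed
  also have "\<dots> = 1 + (\<Sum>k=1..N. \<theta> * exp (\<theta> * real k) * prob {x\<in>space M. T k x \<le> enat N})"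
  proof -
    have int: "integrable M (\<lambda>x. \<theta> * exp (\<theta> * real k) * indicator {x\<in>space M. T k x \<le> enat N} x)" for k
      by (intro integrable_mult_right integrable_real_indicator) (auto simp: less_top[symmetric])
    show ?thesis
      by (simp only: Bochner_Integration.integral_add[OF integrable_const Bochner_Integration.integrable_sum[OF int]]
          Bochner_Integration.integral_sum[OF int] integral_mult_right_zero)
         (simp add: prob_space Int_def conj_commute)
  qed
  also have "\<dots> \<le> 1 + (\<Sum>k=1..N. exp (real N / real n) * (\<theta> * exp (- (\<theta> * real k))))"
  proof (intro add_left_mono sum_mono)
    fix k
    have "real k * (2 * \<theta>) \<le> real k * (b n / 2)" using \<theta>(2) by (intro mult_left_mono) auto
    then have "\<theta> * real k * 2 \<le> real k * (b n / 2)" by (simp add: mult_ac)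
    have "prob {x\<in>space M. T k x \<le> enat N} \<le> exp (real N / real n - real k * (b n / 2))"
      using chernoff[OF n, of "{..<k}" N] by (simp add: T_def)
    also have "\<dots> \<le> exp (real N / real n - \<theta> * real k * 2)"
      using \<open>\<theta> * real k * 2 \<le> real k * (b n / 2)\<close> by simp
    finally have "\<theta> * exp (\<theta> * real k) * prob {x\<in>space M. T k x \<le> enat N}
        \<le> \<theta> * exp (\<theta> * real k) * exp (real N / real n - \<theta> * real k * 2)"
      using \<theta>(1) by (intro mult_left_mono) auto
    also have "\<dots> = \<theta> * (exp (\<theta> * real k + (real N / real n - \<theta> * real k * 2)))"
      by (simp only: exp_add mult.assoc)
    also have "\<theta> * real k + (real N / real n - \<theta> * real k * 2) = real N / real n + - (\<theta> * real k)"
      by simp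
    also have "\<theta> * exp \<dots> = exp (real N / real n) * (\<theta> * exp (- (\<theta> * real k)))"
      by (simp only: exp_add mult_ac)
    finally show "\<theta> * exp (\<theta> * real k) * prob {x\<in>space M. T k x \<le> enat N}
        \<le> exp (real N / real n) * (\<theta> * exp (- (\<theta> * real k)))" .
  qed
  also have "(\<Sum>k=1..N. exp (real N / real n) * (\<theta> * exp (- (\<theta> * real k))))
      = exp (real N / real n) * (\<Sum>k=1..N. \<theta> * exp (- (\<theta> * real k)))"
    by (rule sum_distrib_left[symmetric])
  also have "\<dots> \<le> exp (real N / real n) * 1"
    using sum_exp_minus_le[of \<theta> N] exp_gt_zero[of "- (\<theta> * real N)"]
    by (intro mult_left_mono) (linarith, simp)
  finally show ?thesis by simp
qed

end

text \<open>Because \<open>\<kappa> < 1\<close>, the growth bound on \<open>m\<close> means that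
  \<open>b\<close> decays at least like the power \<open>\<kappa> - 1\<close>; the comparisons
  between scales rest on this decay.\<close>

locale regular_renewal = renewal +
  fixes C \<kappa> :: real
  assumes C1: "C \<ge> 1" and \<kappa>: "0 \<le> \<kappa>" "\<kappa> < 1"
    and m_reg: "\<And>n N. 1 \<le> n \<Longrightarrow> n \<le> N \<Longrightarrow> m N \<le> C * (real N / real n) powr \<kappa> * m n"
begin

lemma b_pos: "n \<ge> 1 \<Longrightarrow> b n > 0"
  using m_ge_1[of n] by (simp add: b_def)

lemma b_le_1: "b n \<le> 1"
  using m_le[of n] by (cases "n = 0") (auto simp: b_def divide_le_eq)

lemma b_regular:
  assumes "1 \<le> n" "n \<le> N"
  shows "b N \<le> C * (real N / real n) powr (\<kappa> - 1) * b n"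
proof -
  have "b N \<le> C * (real N / real n) powr \<kappa> * m n / real N"
    unfolding b_def using m_reg[OF assms] assms by (intro divide_right_mono) auto
  also have "\<dots> = C * ((real N / real n) powr \<kappa> / (real N / real n)) * b n"
    using assms by (simp add: b_def)
  also have "(real N / real n) powr \<kappa> / (real N / real n) = (real N / real n) powr (\<kappa> - 1)"
    using assms by (simp add: powr_diff)
  finally show ?thesis .
qed

lemma b_ratio:
  assumes "1 \<le> n" "n \<le> N"
  shows "b n \<le> real N / real n * b N"
  using m_mono[OF assms(2)] assms by (simp add: b_def field_simps)

text \<open>The rate \<open>c * b N\<close> may exceed the admissible \<open>b N / 4\<close>. At the
  smaller scale \<open>n = N div r\<close> the rate \<open>b n\<close> is larger by the order of
  \<open>r powr (1 - \<kappa>)\<close>, while the price \<open>exp (N / n)\<close> is bounded in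
  terms of \<open>r\<close> alone.\<close>

lemma exp_moment_bounded:
  assumes c: "c \<ge> 0"
  obtains \<Phi> where "\<And>N. N \<ge> 1 \<Longrightarrow> (\<Sum>S\<in>Pow {1..N}. q N S * exp (c * b N * real (card S))) \<le> \<Phi>"
proof -
  have "((\<lambda>r. 4 * c * C * real r powr (\<kappa> - 1)) \<longlongrightarrow> 4 * c * C * 0) sequentially"
    using \<kappa> by (intro tendsto_mult_left tendsto_neg_powr filterlim_real_sequentially) auto
  then have "\<forall>\<^sub>F r in sequentially. 4 * c * C * real r powr (\<kappa> - 1) < 1"
    by (rule order_tendstoD(2)) simp
  moreover have "\<forall>\<^sub>F r in sequentially. r \<ge> (1::nat)" by (rule eventually_ge_at_top)
  ultimately have "\<forall>\<^sub>F r in sequentially. 4 * c * C * real r powr (\<kappa> - 1) < 1 \<and> r \<ge> 1"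
    by (rule eventually_conj)
  then obtain r where r: "4 * c * C * real r powr (\<kappa> - 1) < 1" "r \<ge> 1"
    by (metis (mono_tags, lifting) eventually_sequentially order_refl)
  have "(\<Sum>S\<in>Pow {1..N}. q N S * exp (c * b N * real (card S))) \<le> max (1 + exp (2 * real r)) (exp (c * real r))"
    if N: "N \<ge> 1" for N
  proof (cases "r \<le> N")
    case True
    define n where "n = N div r"
    have n: "1 \<le> n" "n \<le> N" using True r by (auto simp: n_def div_greater_zero_iff Suc_le_eq)
    have nr: "n * r \<le> N" "N < n * r + r"
      using r dividend_less_div_times[of r N] by (auto simp: n_def)
    have 1: "real r \<le> real N / real n"
      using nr(1) n by (simp add: le_divide_eq mult.commute flip: of_nat_mult)
    have "N \<le> n * r + n * r"
      using nr(2) mult_le_mono1[OF n(1), of r] by linarith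
    then have "real N \<le> real (n * r + n * r)" by (rule of_nat_mono)
    then have 2: "real N / real n \<le> 2 * real r"
      using n by (simp add: divide_le_eq mult_ac)
    have "c * b N \<le> c * (C * (real N / real n) powr (\<kappa> - 1) * b n)"
      using b_regular[OF n] c by (intro mult_left_mono) auto
    also have "\<dots> \<le> c * (C * real r powr (\<kappa> - 1) * b n)"
      using 1 r C1 \<kappa> c b_pos[OF n(1)]
      by (intro mult_left_mono mult_right_mono powr_mono2') auto
    also have "\<dots> = (4 * c * C * real r powr (\<kappa> - 1)) * (b n / 4)" by simp
    also have "\<dots> \<le> 1 * (b n / 4)"
      using r b_pos[OF n(1)] by (intro mult_right_mono) auto
    finally have "(\<Sum>S\<in>Pow {1..N}. q N S * exp (c * b N * real (card S))) \<le> 1 + exp (real N / real n)"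
      using c b_pos[OF N] by (intro exp_moment_R[OF n(1)]) auto
    also have "\<dots> \<le> 1 + exp (2 * real r)" using 2 by simp
    finally show ?thesis by simp
  next
    case False
    have "(\<Sum>S\<in>Pow {1..N}. q N S * exp (c * b N * real (card S))) \<le> (\<Sum>S\<in>Pow {1..N}. q N S * exp (c * real r))"
    proof (intro sum_mono mult_left_mono q_nonneg)
      fix S assume "S \<in> Pow {1..N}"
      then have "card S \<le> N" using card_mono[of "{1..N}" S] by simp
      then have "c * b N * real (card S) \<le> c * 1 * real r"
        using False c b_le_1[of N] b_pos[OF N] by (intro mult_mono) auto
      then show "exp (c * b N * real (card S)) \<le> exp (c * real r)" by simp
    qed
    also have "\<dots> = exp (c * real r)" using sum_q[of N] by (simp flip: sum_distrib_right)
    finally show ?thesis by simp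
  qed
  then show thesis by (rule that)
qed

end

section \<open>The potential of a renewal set\<close>

lemma dyadic_scales:
  assumes "N \<ge> 1"
  obtains J where "{j. 2 ^ j \<le> N} = {..J}" "2 ^ J \<le> N" "N < (2::nat) ^ Suc J"
proof -
  obtain J where J: "2 ^ J \<le> N" "N < (2::nat) ^ Suc J"
    using ex_power_ivl1[of 2 N] assms by auto
  have "2 ^ j \<le> N \<longleftrightarrow> j \<le> J" for j
  proof
    assume "2 ^ j \<le> N"
    then have "(2::nat) ^ j < 2 ^ Suc J" using J by linarith
    then have "j < Suc J" by (rule power_less_imp_less_exp[rotated]) simp
    then show "j \<le> J" by simp
  next
    assume "j \<le> J"
    then have "(2::nat) ^ j \<le> 2 ^ J" by (intro power_increasing) auto
    then show "2 ^ j \<le> N" using J by linarith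
  qed
  then show thesis using J by (intro that[of J]) auto
qed

lemma finite_dyadic_scales: "finite {j. 2 ^ j \<le> (N::nat)}"
proof (cases "N \<ge> 1")
  case True
  then show ?thesis by (rule dyadic_scales) simp
qed (simp add: not_le)

text \<open>A geometric series counted downwards from the largest scale, so that the bound does not
  depend on \<open>N\<close>.\<close>

lemma sum_dyadic_le:
  fixes \<delta> :: real
  assumes N: "N \<ge> 1" and \<delta>: "\<delta> > 0"
  shows "(\<Sum>j | 2 ^ j \<le> N. (2 ^ j / real N) powr \<delta>) \<le> 1 / (1 - 2 powr - \<delta>)"
proof -
  obtain J where J: "{j. 2 ^ j \<le> N} = {..J}" "2 ^ J \<le> N"
    using dyadic_scales[OF N] .
  have lt: "2 powr - \<delta> < (1::real)" using powr_less_mono[of "- \<delta>" 0 2] \<delta> by simp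
  have "(\<Sum>j | 2 ^ j \<le> N. (2 ^ j / real N) powr \<delta>) = (\<Sum>i\<le>J. (2 ^ (J - i) / real N) powr \<delta>)"
    unfolding J atMost_atLeast0 by (subst sum.atLeastAtMost_rev) simp
  also have "\<dots> \<le> (\<Sum>i\<le>J. (2 powr - \<delta>) ^ i)"
  proof (intro sum_mono)
    fix i assume i: "i \<in> {..J}"
    have JN: "2 ^ J \<le> real N" using of_nat_mono[OF J(2), where 'a = real] by simp
    have "2 ^ (J - i) / real N \<le> 2 ^ (J - i) / 2 ^ J"
      using JN N by (intro divide_left_mono) auto
    also have "\<dots> = 2 powr - real i"
      using i by (simp add: power_diff powr_minus powr_realpow field_simps)
    finally have "(2 ^ (J - i) / real N) powr \<delta> \<le> (2 powr - real i) powr \<delta>"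
      using \<delta> by (intro powr_mono2) auto
    also have "\<dots> = (2 powr - \<delta>) ^ i"
      by (simp add: powr_powr powr_power mult.commute)
    finally show "(2 ^ (J - i) / real N) powr \<delta> \<le> (2 powr - \<delta>) ^ i" .
  qed
  also have "\<dots> = (1 - (2 powr - \<delta>) ^ Suc J) / (1 - 2 powr - \<delta>)"
    using lt \<delta> by (simp add: sum_gp0)
  also have "\<dots> \<le> 1 / (1 - 2 powr - \<delta>)"
    using lt by (intro divide_right_mono) auto
  finally show ?thesis .
qed

lemma powr_times_exp_bounded:
  fixes p :: real
  obtains A where "A > 0" "\<And>y. y \<ge> 1 \<Longrightarrow> y powr p * exp (- y / 2) \<le> A"
proof -
  define n where "n = nat \<lceil>max 1 p\<rceil>"
  have n: "p \<le> real n" "n \<ge> 1" unfolding n_def by linarith+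
  have "y powr p * exp (- y / 2) \<le> (2 * real n) ^ n" if "y \<ge> 1" for y
  proof -
    have "y / (2 * real n) \<le> exp (y / (2 * real n))"
      using exp_ge_add_one_self[of "y / (2 * real n)"] by linarith
    then have "(y / (2 * real n)) ^ n \<le> exp (y / (2 * real n)) ^ n"
      using that by (intro power_mono) auto
    also have "\<dots> = exp (y / 2)" using n by (simp flip: exp_of_nat_mult)
    finally have "y ^ n \<le> (2 * real n) ^ n * exp (y / 2)"
      using n by (simp add: power_divide divide_le_eq mult.commute)
    moreover have "y powr p \<le> y ^ n"
      using powr_mono[OF n(1) that] that by (simp add: powr_realpow)
    ultimately have "y powr p * exp (- y / 2) \<le> (2 * real n) ^ n * exp (y / 2) * exp (- y / 2)"
      by (intro mult_right_mono) auto
    also have "\<dots> = (2 * real n) ^ n" by (simp add: mult.assoc mult_exp_exp)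
    finally show ?thesis .
  qed
  then show thesis using n by (intro that[of "(2 * real n) ^ n"]) auto
qed

text \<open>A Riesz-type potential of \<open>S\<close> at \<open>n\<close>. The shift by 1 gives the
  diagonal term the value 1, where \<open>0 powr - s\<close> would be 0.\<close>

definition interaction :: "real \<Rightarrow> nat set \<Rightarrow> nat \<Rightarrow> real" where
  "interaction s S n = (\<Sum>m\<in>S. (\<bar>real n - real m\<bar> + 1) powr - s)"

text \<open>A point at distance d is charged to the scale with
  \<open>2 ^ j \<le> d + 1 < 2 ^ Suc j\<close>. Keeping only the upper restriction replaces shells
  by windows and can only enlarge the sum.\<close>

lemma interaction_le_dyadic:
  assumes N: "N \<ge> 1" and S: "S \<subseteq> {1..N}" and n: "n \<in> {1..N}" and s: "s \<ge> 0"
  shows "interaction s S n \<le>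
    (\<Sum>j | 2 ^ j \<le> N. (2 ^ j) powr - s * real (card {m\<in>S. \<bar>real n - real m\<bar> + 1 < 2 ^ Suc j}))"
proof -
  have fS: "finite S" using S by (rule finite_subset) simp
  have "interaction s S n \<le> (\<Sum>m\<in>S. \<Sum>j | 2 ^ j \<le> N. if \<bar>real n - real m\<bar> + 1 < 2 ^ Suc j then (2 ^ j) powr - s else 0)"
    unfolding interaction_def
  proof (intro sum_mono)
    fix m assume m: "m \<in> S"
    define d where "d = (if m \<le> n then n - m else m - n) + 1"
    have d: "\<bar>real n - real m\<bar> + 1 = real d" by (auto simp: d_def of_nat_diff)
    have "m \<in> {1..N}" using S m by blast
    then have "1 \<le> d" "d \<le> N" using n unfolding d_def by (auto split: if_splits)
    then obtain j where j: "2 ^ j \<le> d" "d < 2 ^ Suc j" "2 ^ j \<le> N"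
      using ex_power_ivl1[of 2 d] by auto
    have j': "2 ^ j \<le> real d" "real d < 2 ^ Suc j"
      using j(1,2) by (auto simp flip: of_nat_le_iff of_nat_less_iff[where 'a = real])
    have "real d powr - s \<le> (2 ^ j) powr - s"
      using j' s by (intro powr_mono2') auto
    also have "\<dots> = (if real d < 2 ^ Suc j then (2 ^ j) powr - s else 0)" using j' by simp
    also have "\<dots> \<le> (\<Sum>j | 2 ^ j \<le> N. if real d < 2 ^ Suc j then (2 ^ j) powr - s else 0)"
      using j(3) finite_dyadic_scales[of N] by (intro member_le_sum) auto
    finally show "(\<bar>real n - real m\<bar> + 1) powr - s \<le>
        (\<Sum>j | 2 ^ j \<le> N. if \<bar>real n - real m\<bar> + 1 < 2 ^ Suc j then (2 ^ j) powr - s else 0)"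
      unfolding d .
  qed
  also have "\<dots> = (\<Sum>j | 2 ^ j \<le> N. \<Sum>m\<in>S. if \<bar>real n - real m\<bar> + 1 < 2 ^ Suc j then (2 ^ j) powr - s else 0)"
    by (rule sum.swap)
  also have "\<dots> = (\<Sum>j | 2 ^ j \<le> N. (2 ^ j) powr - s * real (card {m\<in>S. \<bar>real n - real m\<bar> + 1 < 2 ^ Suc j}))"
    using fS by (intro sum.cong refl) (simp add: sum.inter_filter[symmetric] mult.commute)
  finally show ?thesis .
qed

context renewal
begin

text \<open>More than \<open>2 * k\<close> points near \<open>n\<close> would force a whole aligned
  block of \<open>k\<close> increments into a window of length \<open>2 ^ (j + 2)\<close>, while
  every block starting before index \<open>Q\<close> is longer.\<close>

lemma card_near_le:
  assumes k: "k \<ge> 1" and N: "enat N < T Q x"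
    and blocks: "\<And>i. i * k < Q \<Longrightarrow> enat (2 ^ (j + 2)) < (\<Sum>l\<in>{i * k..<Suc i * k}. \<xi> l x)"
  shows "card {m \<in> R N x. \<bar>real n - real m\<bar> + 1 < 2 ^ Suc j} \<le> 2 * k"
proof (rule ccontr)
  \<comment> \<open>Truncated subtraction cuts the window at 0 and the minimum cuts it at
    \<open>N\<close>; its length is at most \<open>2 * 2 ^ Suc j = 2 ^ (j + 2)\<close>.\<close>
  define a b' :: nat where "a = n - 2 ^ Suc j" and "b' = min N (n + 2 ^ Suc j)"
  assume "\<not> ?thesis"
  then have large: "2 * k < card {m \<in> R N x. \<bar>real n - real m\<bar> + 1 < 2 ^ Suc j}" by simp
  have "{m \<in> R N x. \<bar>real n - real m\<bar> + 1 < 2 ^ Suc j} \<subseteq> {m\<in>{a..b'}. \<exists>i. T i x = enat m}"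
  proof safe
    fix m assume m: "m \<in> R N x" and near: "\<bar>real n - real m\<bar> + 1 < 2 ^ Suc j"
    have "real n < real (m + 2 ^ Suc j)" "real m < real (n + 2 ^ Suc j)" using near by auto
    then have "n < m + 2 ^ Suc j" "m < n + 2 ^ Suc j" by (auto simp only: of_nat_less_iff)
    moreover have "m \<le> N" using m by (simp add: R_eq)
    ultimately show "m \<in> {a..b'}" by (auto simp: a_def b'_def)
    show "\<exists>i. T i x = enat m" using m by (simp add: R_eq)
  qed
  then have "card {m \<in> R N x. \<bar>real n - real m\<bar> + 1 < 2 ^ Suc j} \<le> card {m\<in>{a..b'}. \<exists>i. T i x = enat m}"
    by (intro card_mono) auto
  then have "2 * k \<le> card {m\<in>{a..b'}. \<exists>i. T i x = enat m}"
    using large by linarith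
  then obtain i where i: "enat a \<le> T (i * k) x" "T (Suc i * k) x \<le> enat b'"
    using aligned_block[OF mono_T k] by blast
  \<comment> \<open>A block starting at index \<open>Q\<close> or later would end beyond
    \<open>N\<close>, hence outside the window.\<close>
  have "i * k < Q"
  proof (rule ccontr)
    assume "\<not> i * k < Q"
    then have "T Q x \<le> T (Suc i * k) x" by (intro monoD[OF mono_T]) auto
    also have "\<dots> \<le> enat N" using i(2) by (rule order_trans) (simp add: b'_def)
    finally show False using N by simp
  qed
  then have long: "enat (2 ^ (j + 2)) < (\<Sum>l\<in>{i * k..<Suc i * k}. \<xi> l x)" by (rule blocks)
  have "T (Suc i * k) x = T (i * k) x + (\<Sum>l\<in>{i * k..<Suc i * k}. \<xi> l x)"
    by (rule T_split) simp
  then have "enat a + (\<Sum>l\<in>{i * k..<Suc i * k}. \<xi> l x) \<le> enat b'"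
    using i by (metis add_right_mono order_trans)
  moreover have "enat b' \<le> enat a + enat (2 ^ (j + 2))"
    by (simp add: a_def b'_def)
  ultimately have "enat a + (\<Sum>l\<in>{i * k..<Suc i * k}. \<xi> l x) \<le> enat a + enat (2 ^ (j + 2))"
    by (rule order_trans)
  then have "(\<Sum>l\<in>{i * k..<Suc i * k}. \<xi> l x) \<le> enat (2 ^ (j + 2))"
    by (simp only: enat_add_left_cancel_le enat.distinct simp_thms)
  then show False using long by (meson leD)
qed

end

section \<open>Simultaneous control of the windows on all dyadic scales\<close>

context regular_renewal
begin

text \<open>A window of length \<open>2 ^ j\<close> typically holds of order
  \<open>1 / b (2 ^ j)\<close> points. The slack \<open>(N / 2 ^ j) powr \<epsilon>\<close> makes
  exceptions rare enough for a union bound over all blocks of that scale.\<close>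

definition block_length :: "real \<Rightarrow> real \<Rightarrow> nat \<Rightarrow> nat \<Rightarrow> nat" where
  "block_length \<epsilon> K N j = nat \<lceil>K * (real N / 2 ^ j) powr \<epsilon> / b (2 ^ j)\<rceil>"

definition index_bound :: "real \<Rightarrow> nat \<Rightarrow> nat" where
  "index_bound K N = nat \<lceil>K / b N\<rceil>"

definition short_block :: "real \<Rightarrow> real \<Rightarrow> nat \<Rightarrow> nat \<Rightarrow> nat \<Rightarrow> 'a set" where
  "short_block \<epsilon> K N j i =
    {x\<in>space M. (\<Sum>l\<in>{i * block_length \<epsilon> K N j..<Suc i * block_length \<epsilon> K N j}. \<xi> l x) \<le> enat (2 ^ (j + 2))}"

text \<open>Bounding the number of renewals first leaves only finitely many blocks per scale for the
  union bound.\<close>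

definition bad_event :: "real \<Rightarrow> real \<Rightarrow> nat \<Rightarrow> 'a set" where
  "bad_event \<epsilon> K N = {x\<in>space M. T (index_bound K N) x \<le> enat N} \<union>
    (\<Union>j\<in>{j. 2 ^ j \<le> N}. \<Union>i\<in>{i. i * block_length \<epsilon> K N j < index_bound K N}. short_block \<epsilon> K N j i)"

lemma b_dyadic_pos: "b (2 ^ j) > 0"
  by (rule b_pos) simp

lemma block_length_bounds:
  assumes K: "K \<ge> 1" and \<epsilon>: "\<epsilon> > 0" and j: "2 ^ j \<le> N"
  defines "y \<equiv> K * (real N / 2 ^ j) powr \<epsilon> / b (2 ^ j)"
  shows "1 \<le> block_length \<epsilon> K N j" "y \<le> real (block_length \<epsilon> K N j)"
    "real (block_length \<epsilon> K N j) \<le> 2 * y"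
proof -
  have "2 ^ j \<le> real N" using of_nat_mono[OF j, where 'a = real] by simp
  then have "1 \<le> (real N / 2 ^ j) powr \<epsilon>"
    using \<epsilon> by (intro ge_one_powr_ge_zero) auto
  then have "1 * 1 \<le> K * (real N / 2 ^ j) powr \<epsilon>"
    using K by (intro mult_mono) auto
  then have "1 * 1 \<le> y"
    using b_le_1[of "2 ^ j"] b_dyadic_pos[of j] by (simp add: y_def le_divide_eq)
  then have "y \<ge> 1" by simp
  from nat_ceiling_bounds[OF this] show "1 \<le> block_length \<epsilon> K N j"
    "y \<le> real (block_length \<epsilon> K N j)" "real (block_length \<epsilon> K N j) \<le> 2 * y"
    by (simp_all add: block_length_def y_def)
qed

text \<open>With r = N / 2^j, a window of scale j holds at most
  \<open>4 * K * r powr \<epsilon> / b (2 ^ j)\<close> points. By the decay of \<open>b\<close> its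
  contribution is of order \<open>r powr (s + \<epsilon> + \<kappa> - 1)\<close>, and the negative
  exponent makes the sum over scales geometric.\<close>

lemma interaction_le_off_bad_event:
  assumes \<epsilon>: "\<epsilon> > 0" and s: "s \<ge> 0" and \<delta>: "0 < 1 - \<kappa> - s - \<epsilon>"
    and K: "K \<ge> 1" and x: "x \<in> space M" "x \<notin> bad_event \<epsilon> K N" and n: "n \<in> {1..N}"
  shows "b N * real N powr s * interaction s (R N x) n
    \<le> 4 * C / (1 - 2 powr - (1 - \<kappa> - s - \<epsilon>)) * K"
proof -
  let ?\<delta> = "1 - \<kappa> - s - \<epsilon>"
  have N: "N \<ge> 1" using n by simp
  have TQ: "enat N < T (index_bound K N) x"
    using x by (auto simp: bad_event_def not_le)
  have blocks: "enat (2 ^ (j + 2)) < (\<Sum>l\<in>{i * block_length \<epsilon> K N j..<Suc i * block_length \<epsilon> K N j}. \<xi> l x)"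
    if "2 ^ j \<le> N" "i * block_length \<epsilon> K N j < index_bound K N" for i j
  proof -
    have "x \<notin> short_block \<epsilon> K N j i" using x(2) that by (auto simp: bad_event_def)
    then show ?thesis using x(1) by (simp add: short_block_def not_le)
  qed
  have "b N * real N powr s * interaction s (R N x) n \<le>
    b N * real N powr s * (\<Sum>j | 2 ^ j \<le> N. (2 ^ j) powr - s * real (card {m\<in>R N x. \<bar>real n - real m\<bar> + 1 < 2 ^ Suc j}))"
    using b_pos[OF N] by (intro mult_left_mono interaction_le_dyadic[OF N R_subset n s] mult_nonneg_nonneg) auto
  also have "\<dots> = (\<Sum>j | 2 ^ j \<le> N. b N * real N powr s * ((2 ^ j) powr - s * real (card {m\<in>R N x. \<bar>real n - real m\<bar> + 1 < 2 ^ Suc j})))"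
    by (rule sum_distrib_left)
  also have "\<dots> \<le> (\<Sum>j | 2 ^ j \<le> N. 4 * C * K * (2 ^ j / real N) powr ?\<delta>)"
  proof (intro sum_mono)
    fix j assume "j \<in> {j. 2 ^ j \<le> N}"
    then have j: "2 ^ j \<le> N" by simp
    define r where "r = real N / 2 ^ j"
    have jr: "2 ^ j \<le> real N" using of_nat_mono[OF j, where 'a = real] by simp
    then have r: "r \<ge> 1" by (simp add: r_def)
    have bj: "b (2 ^ j) > 0" by (rule b_dyadic_pos)
    have "card {m\<in>R N x. \<bar>real n - real m\<bar> + 1 < 2 ^ Suc j} \<le> 2 * block_length \<epsilon> K N j"
      by (rule card_near_le[OF block_length_bounds(1)[OF K \<epsilon> j] TQ]) (rule blocks[OF j])
    then have "real (card {m\<in>R N x. \<bar>real n - real m\<bar> + 1 < 2 ^ Suc j}) \<le> 2 * real (block_length \<epsilon> K N j)"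
      by linarith
    also have "\<dots> \<le> 4 * (K * r powr \<epsilon> / b (2 ^ j))"
      using block_length_bounds(3)[OF K \<epsilon> j] by (simp add: r_def)
    finally have "b N * real N powr s * ((2 ^ j) powr - s * real (card {m\<in>R N x. \<bar>real n - real m\<bar> + 1 < 2 ^ Suc j}))
        \<le> b N * real N powr s * ((2 ^ j) powr - s * (4 * (K * r powr \<epsilon> / b (2 ^ j))))"
      using b_pos[OF N] by (intro mult_left_mono mult_nonneg_nonneg) auto
    also have "\<dots> = 4 * K * (r powr s * r powr \<epsilon>) * (b N / b (2 ^ j))"
      using jr by (simp add: r_def powr_divide powr_minus_divide mult_ac)
    also have "b N / b (2 ^ j) \<le> C * r powr (\<kappa> - 1)"
      using b_regular[OF _ j] bj by (simp add: r_def divide_le_eq)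
    finally have "b N * real N powr s * ((2 ^ j) powr - s * real (card {m\<in>R N x. \<bar>real n - real m\<bar> + 1 < 2 ^ Suc j}))
        \<le> 4 * K * (r powr s * r powr \<epsilon>) * (C * r powr (\<kappa> - 1))"
      using K by (simp add: mult_left_mono)
    also have "\<dots> = 4 * C * K * (r powr s * r powr \<epsilon> * r powr (\<kappa> - 1))" by simp
    also have "r powr s * r powr \<epsilon> * r powr (\<kappa> - 1) = r powr (- ?\<delta>)"
      by (simp flip: powr_add) (simp add: algebra_simps)
    also have "r powr (- ?\<delta>) = (2 ^ j / real N) powr ?\<delta>"
      using jr N by (simp add: r_def powr_minus powr_divide del: minus_diff_eq minus_add_distrib)
    finally show "b N * real N powr s * ((2 ^ j) powr - s * real (card {m\<in>R N x. \<bar>real n - real m\<bar> + 1 < 2 ^ Suc j}))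
      \<le> 4 * C * K * (2 ^ j / real N) powr ?\<delta>" .
  qed
  also have "\<dots> = 4 * C * K * (\<Sum>j | 2 ^ j \<le> N. (2 ^ j / real N) powr ?\<delta>)"
    by (rule sum_distrib_left[symmetric])
  also have "\<dots> \<le> 4 * C * K * (1 / (1 - 2 powr - ?\<delta>))"
    using C1 K by (intro mult_left_mono sum_dyadic_le[OF N \<delta>]) auto
  finally show ?thesis by simp
qed

lemma short_block_meas [measurable]: "short_block \<epsilon> K N j i \<in> events"
  unfolding short_block_def by measurable

lemma bad_event_meas [measurable]: "bad_event \<epsilon> K N \<in> events"
  unfolding bad_event_def
  by (intro sets.Un sets.countable_UN' countableI_type) (auto simp: short_block_meas)

lemma finite_blocks:
  assumes "block_length \<epsilon> K N j \<ge> 1"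
  shows "finite {i. i * block_length \<epsilon> K N j < Q}"
    "real (card {i. i * block_length \<epsilon> K N j < Q}) \<le> real Q / real (block_length \<epsilon> K N j) + 1"
proof -
  let ?k = "block_length \<epsilon> K N j"
  have sub: "{i. i * ?k < Q} \<subseteq> {..Q div ?k}"
  proof safe
    fix i assume "i * ?k < Q"
    then have "i * ?k div ?k \<le> Q div ?k" by (intro div_le_mono) simp
    then show "i \<le> Q div ?k" using assms by simp
  qed
  then show "finite {i. i * ?k < Q}" by (rule finite_subset) simp
  have "card {i. i * ?k < Q} \<le> Q div ?k + 1"
    using card_mono[OF _ sub] by simp
  then have "real (card {i. i * ?k < Q}) \<le> real (Q div ?k + 1)" by (rule of_nat_mono)
  also have "\<dots> \<le> real Q / real ?k + 1" using of_nat_div_le_of_nat[of Q ?k] by simp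
  finally show "real (card {i. i * ?k < Q}) \<le> real Q / real ?k + 1" .
qed

text \<open>With r = N / 2^j there are at most 3r blocks at scale j, each short with probability of
  order 1/(K r^2). The remaining 1/r is summable over dyadic scales.\<close>

lemma prob_bad_event:
  assumes \<epsilon>: "0 < \<epsilon>" "\<epsilon> \<le> 1"
  obtains D where "D > 0" "\<And>K N. K \<ge> 1 \<Longrightarrow> N \<ge> 1 \<Longrightarrow> prob (bad_event \<epsilon> K N) \<le> D / K"
proof -
  \<comment> \<open>The power is chosen so that
    \<open>(K * r powr \<epsilon>) powr (2 / \<epsilon>)\<close> is at least
    \<open>K * r\<^sup>2\<close>.\<close>
  obtain A where A: "A > 0" "\<And>y. y \<ge> 1 \<Longrightarrow> y powr (2 / \<epsilon>) * exp (- y / 2) \<le> A"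
    by (rule powr_times_exp_bounded[of "2 / \<epsilon>"]) blast
  \<comment> \<open>The term \<open>2 * exp 1\<close> accounts for the number of renewals. The 6 is
    3 times the bound 2 for the geometric sum, and \<open>exp 4\<close> arises because the windows
    are 4 times as long as the Chernoff scale \<open>2 ^ j\<close>.\<close>
  have "prob (bad_event \<epsilon> K N) \<le> (2 * exp 1 + 6 * exp 4 * A) / K" if K: "K \<ge> 1" and N: "N \<ge> 1" for K N
  proof -
    let ?Q = "index_bound K N"
    let ?k = "block_length \<epsilon> K N"
    have bN: "0 < b N" "b N \<le> 1" by (rule b_pos[OF N], rule b_le_1)
    have "K / b N \<ge> 1" using K bN by (simp add: le_divide_eq)
    then have Q: "K / b N \<le> real ?Q" "real ?Q \<le> K / b N + 1"
      using nat_ceiling_bounds[of "K / b N"] by (auto simp: index_bound_def)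
    have first: "prob {x\<in>space M. T ?Q x \<le> enat N} \<le> 2 * exp 1 / K"
    proof -
      have "prob {x\<in>space M. T ?Q x \<le> enat N} \<le> exp (1 - real ?Q * (b N / 2))"
        using chernoff[OF N, of "{..<?Q}" N] N by (simp add: T_def)
      also have "K \<le> real ?Q * b N" using Q bN by (simp add: divide_le_eq)
      then have "exp (1 - real ?Q * (b N / 2)) \<le> exp (1 - K / 2)" by simp
      also have "\<dots> = exp 1 / exp (K / 2)" by (rule exp_diff)
      also have "\<dots> \<le> exp 1 / (K / 2)"
        using exp_ge_add_one_self[of "K / 2"] K by (intro divide_left_mono) (linarith, simp_all)
      finally show ?thesis by (simp add: mult.commute)
    qed
    have scale: "prob (\<Union>i\<in>{i. i * ?k j < ?Q}. short_block \<epsilon> K N j i) \<le> 3 * exp 4 * A / K * (2 ^ j / real N) powr 1"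
      if j: "2 ^ j \<le> N" for j
    proof -
      define r where "r = real N / 2 ^ j"
      have jr: "2 ^ j \<le> real N" using of_nat_mono[OF j, where 'a = real] by simp
      then have r: "r \<ge> 1" by (simp add: r_def)
      have bj: "0 < b (2 ^ j)" "b (2 ^ j) \<le> 1" by (rule b_dyadic_pos, rule b_le_1)
      note k = block_length_bounds[OF K \<epsilon>(1) j, folded r_def]
      have one: "prob (short_block \<epsilon> K N j i) \<le> exp 4 * (A / (K * r\<^sup>2))" for i
      proof -
        define y where "y = K * r powr \<epsilon>"
        have re: "r powr \<epsilon> \<ge> 1" using r \<epsilon> by (intro ge_one_powr_ge_zero) auto
        then have "1 * 1 \<le> y" unfolding y_def using K by (intro mult_mono) auto
        then have y: "y \<ge> 1" by simp
        have "prob (short_block \<epsilon> K N j i) \<le> exp (4 - real (?k j) * (b (2 ^ j) / 2))"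
          using chernoff[of "2 ^ j" "{i * ?k j..<Suc i * ?k j}" "2 ^ (j + 2)"]
          by (simp add: short_block_def power_add)
        also have "y \<le> real (?k j) * b (2 ^ j)"
          using k(2) bj by (simp add: y_def divide_le_eq)
        then have "exp (4 - real (?k j) * (b (2 ^ j) / 2)) \<le> exp (4 + - y / 2)" by simp
        also have "\<dots> = exp 4 * exp (- y / 2)" by (rule exp_add)
        also have "exp (- y / 2) \<le> A / (K * r\<^sup>2)"
        proof -
          have "K * r\<^sup>2 \<le> K powr (2 / \<epsilon>) * r\<^sup>2"
            using powr_mono[of 1 "2 / \<epsilon>" K] K \<epsilon> by (intro mult_right_mono) auto
          also have "\<dots> = y powr (2 / \<epsilon>)"
            using K r \<epsilon> by (simp add: y_def powr_mult powr_powr powr_numeral)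
          finally have "exp (- y / 2) * (K * r\<^sup>2) \<le> exp (- y / 2) * y powr (2 / \<epsilon>)"
            by (intro mult_left_mono) auto
          also have "\<dots> \<le> A" using A(2)[OF y] by (simp add: mult.commute)
          finally show ?thesis using K r by (simp add: le_divide_eq)
        qed
        finally show ?thesis by simp
      qed
      \<comment> \<open>Monotonicity of \<open>m\<close> gives
        \<open>1 / b N \<le> r / b (2 ^ j)\<close>, so the index bound spans at most
        \<open>r + 1\<close> block lengths.\<close>
      have count: "real (card {i. i * ?k j < ?Q}) \<le> 3 * r"
      proof -
        have "real ?Q \<le> r * real (?k j) + real (?k j)"
        proof -
          have "K / b N \<le> r * (K / b (2 ^ j))"
            using b_ratio[OF _ j] bj bN K by (simp add: r_def field_simps)
          also have "K \<le> K * r powr \<epsilon>"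
            using K r \<epsilon> ge_one_powr_ge_zero[of r \<epsilon>] by (simp add: mult_le_cancel_left1)
          then have "K / b (2 ^ j) \<le> real (?k j)"
            using k(2) bj by (intro order_trans[OF divide_right_mono k(2)]) auto
          then have "r * (K / b (2 ^ j)) \<le> r * real (?k j)" using r by (intro mult_left_mono) auto
          finally show ?thesis using Q(2) k(1) by linarith
        qed
        then have "real ?Q / real (?k j) \<le> r + 1" using k(1) by (simp add: divide_le_eq algebra_simps)
        then show ?thesis using finite_blocks(2)[OF k(1), of ?Q] r by linarith
      qed
      have "prob (\<Union>i\<in>{i. i * ?k j < ?Q}. short_block \<epsilon> K N j i) \<le> (\<Sum>i | i * ?k j < ?Q. prob (short_block \<epsilon> K N j i))"
        by (intro finite_measure_subadditive_finite finite_blocks[OF k(1)]) (auto simp: short_block_meas)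
      also have "\<dots> \<le> real (card {i. i * ?k j < ?Q}) * (exp 4 * (A / (K * r\<^sup>2)))"
        using sum_mono[of _ "\<lambda>i. prob (short_block \<epsilon> K N j i)" "\<lambda>_. exp 4 * (A / (K * r\<^sup>2))"] one by simp
      also have "\<dots> \<le> 3 * r * (exp 4 * (A / (K * r\<^sup>2)))"
        using count A K r by (intro mult_right_mono) auto
      also have "\<dots> = 3 * exp 4 * A / K * (1 / r)"
        using r by (simp add: power2_eq_square)
      also have "1 / r = (2 ^ j / real N) powr 1" by (simp add: r_def)
      finally show ?thesis .
    qed
    have "prob (bad_event \<epsilon> K N) \<le> prob {x\<in>space M. T ?Q x \<le> enat N}
        + prob (\<Union>j\<in>{j. 2 ^ j \<le> N}. \<Union>i\<in>{i. i * ?k j < ?Q}. short_block \<epsilon> K N j i)"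
      unfolding bad_event_def
      by (intro measure_Un_le sets.countable_UN' countableI_type) (auto simp: short_block_meas)
    also have "prob (\<Union>j\<in>{j. 2 ^ j \<le> N}. \<Union>i\<in>{i. i * ?k j < ?Q}. short_block \<epsilon> K N j i)
        \<le> (\<Sum>j | 2 ^ j \<le> N. prob (\<Union>i\<in>{i. i * ?k j < ?Q}. short_block \<epsilon> K N j i))"
      by (intro finite_measure_subadditive_finite finite_dyadic_scales image_subsetI
            sets.countable_UN' countableI_type) (auto simp: short_block_meas)
    also have "\<dots> \<le> (\<Sum>j | 2 ^ j \<le> N. 3 * exp 4 * A / K * (2 ^ j / real N) powr 1)"
      using scale by (intro sum_mono) auto
    also have "\<dots> = 3 * exp 4 * A / K * (\<Sum>j | 2 ^ j \<le> N. (2 ^ j / real N) powr 1)"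
      by (rule sum_distrib_left[symmetric])
    also have "\<dots> \<le> 3 * exp 4 * A / K * (1 / (1 - 2 powr - 1))"
      using A K by (intro mult_left_mono sum_dyadic_le[OF N]) auto
    also have "\<dots> = 6 * exp 4 * A / K" by (simp add: powr_minus)
    finally show ?thesis using first by (simp add: add_divide_distrib)
  qed
  then show thesis using A by (intro that[of "2 * exp 1 + 6 * exp 4 * A"]) (auto intro: add_pos_pos)
qed

lemma interaction_tight:
  assumes s: "s \<ge> 0" "\<kappa> + s < 1"
  obtains D where "D > 0"
    "\<And>K N. K \<ge> 1 \<Longrightarrow> N \<ge> 1 \<Longrightarrow>
      (\<Sum>S | S \<subseteq> {1..N} \<and> (\<exists>n\<in>{1..N}. b N * real N powr s * interaction s S n > D * K). q N S) \<le> D / K"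
proof -
  \<comment> \<open>Half of the gap is spent as slack in the block lengths, and the other half
    remains as decay exponent over the scales.\<close>
  define \<epsilon> where "\<epsilon> = (1 - \<kappa> - s) / 2"
  have \<epsilon>: "0 < \<epsilon>" "\<epsilon> \<le> 1" "0 < 1 - \<kappa> - s - \<epsilon>"
    using s \<kappa> by (auto simp: \<epsilon>_def)
  obtain D1 where D1: "D1 > 0" "\<And>K N. K \<ge> 1 \<Longrightarrow> N \<ge> 1 \<Longrightarrow> prob (bad_event \<epsilon> K N) \<le> D1 / K"
    by (rule prob_bad_event[OF \<epsilon>(1,2)]) blast
  define D2 where "D2 = 4 * C / (1 - 2 powr - (1 - \<kappa> - s - \<epsilon>))"
  define D where "D = max D1 D2"
  have "(\<Sum>S | S \<subseteq> {1..N} \<and> (\<exists>n\<in>{1..N}. b N * real N powr s * interaction s S n > D * K). q N S) \<le> D / K"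
    if K: "K \<ge> 1" and N: "N \<ge> 1" for K N
  proof -
    define G where "G S \<longleftrightarrow> (\<exists>n\<in>{1..N}. b N * real N powr s * interaction s S n > D * K)" for S
    have "(\<Sum>S | S \<subseteq> {1..N} \<and> G S. q N S) = (\<Sum>S\<in>Pow {1..N}. q N S * indicator {S. G S} S)"
      by (auto simp: indicator_def if_distrib sum.inter_filter[symmetric] Pow_def intro!: sum.cong cong: if_cong)
    also have "\<dots> = expectation (\<lambda>x. indicator {S. G S} (R N x))"
      by (rule expectation_R[symmetric])
    also have "\<dots> \<le> expectation (indicator (bad_event \<epsilon> K N))"
    proof (rule integral_mono[OF integrable_R])
      show "integrable M (indicator (bad_event \<epsilon> K N) :: 'a \<Rightarrow> real)"
        by (intro integrable_real_indicator) (auto simp: less_top[symmetric])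
      fix x assume x: "x \<in> space M"
      show "indicator {S. G S} (R N x) \<le> (indicator (bad_event \<epsilon> K N) x :: real)"
      proof (cases "x \<in> bad_event \<epsilon> K N")
        case False
        have "\<not> G (R N x)"
        proof
          assume "G (R N x)"
          then obtain n where n: "n \<in> {1..N}" "b N * real N powr s * interaction s (R N x) n > D * K"
            by (auto simp: G_def)
          have "b N * real N powr s * interaction s (R N x) n \<le> D2 * K"
            unfolding D2_def by (rule interaction_le_off_bad_event[OF \<epsilon>(1) s(1) \<epsilon>(3) K x False n(1)])
          also have "\<dots> \<le> D * K" using K by (intro mult_right_mono) (auto simp: D_def)
          finally show False using n(2) by simp
        qed
        then show ?thesis by simp
      qed (simp add: indicator_def)
    qed
    also have "\<dots> = prob (bad_event \<epsilon> K N)" by simp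
    also have "\<dots> \<le> D1 / K" by (rule D1(2)[OF K N])
    also have "\<dots> \<le> D / K" using K by (intro divide_right_mono) (auto simp: D_def)
    finally show ?thesis by (simp add: G_def)
  qed
  then show thesis using D1(1) by (intro that[of D]) (auto simp: D_def)
qed

end

section \<open>Wick exponentials\<close>

text \<open>Completing the square: exponential tilting of a centred normal law moves its mean to the
  variance.\<close>

lemma exp_times_normal_density:
  assumes "\<sigma> > 0"
  shows "normal_density 0 \<sigma> x * exp x = exp (\<sigma>\<^sup>2 / 2) * normal_density (\<sigma>\<^sup>2) \<sigma> x"
proof -
  have "- (x - 0)\<^sup>2 / (2 * \<sigma>\<^sup>2) + x = \<sigma>\<^sup>2 / 2 + - (x - \<sigma>\<^sup>2)\<^sup>2 / (2 * \<sigma>\<^sup>2)"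
    using assms by (simp add: field_simps power2_eq_square)
  then have "exp (- (x - 0)\<^sup>2 / (2 * \<sigma>\<^sup>2)) * exp x = exp (\<sigma>\<^sup>2 / 2) * exp (- (x - \<sigma>\<^sup>2)\<^sup>2 / (2 * \<sigma>\<^sup>2))"
    by (simp only: flip: exp_add)
  then show ?thesis
    unfolding normal_density_def by (simp add: mult.left_commute mult.assoc)
qed

lemma (in prob_space) gaussian_rv_centered:
  assumes "gaussian_rv M X" and mean: "expectation X = 0"
  shows "integrable M (\<lambda>w. (X w)\<^sup>2)" "integrable M X"
    "has_bochner_integral M (\<lambda>w. exp (X w)) (exp (expectation (\<lambda>w. (X w)\<^sup>2) / 2))"
proof -
  have X [measurable]: "X \<in> borel_measurable M"
    using assms(1) by (simp add: gaussian_rv_def)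
  consider \<mu> \<sigma> where "\<sigma> > 0" "distributed M lborel X (normal_density \<mu> \<sigma>)" | c where "AE w in M. X w = c"
    using assms(1) unfolding gaussian_rv_def by blast
  then have "integrable M (\<lambda>w. (X w)\<^sup>2) \<and> integrable M X \<and>
    has_bochner_integral M (\<lambda>w. exp (X w)) (exp (expectation (\<lambda>w. (X w)\<^sup>2) / 2))"
  proof cases
    case (1 \<mu> \<sigma>)
    have "\<mu> = 0" using normal_distributed_expectation[OF 1] mean by simp
    then have d: "distributed M lborel X (normal_density 0 \<sigma>)" using 1 by simp
    note int = distributed_integrable[OF d] and intg = distributed_integral[OF d]
    have sq: "integrable M (\<lambda>w. (X w)\<^sup>2)"
      using integrable_normal_moment[OF 1(1), of 0 2] int[of "\<lambda>x. x\<^sup>2"] by simp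
    have "integrable M X"
      using integrable_normal_moment[OF 1(1), of 0 1] int[of "\<lambda>x. x"] by simp
    moreover have var: "expectation (\<lambda>w. (X w)\<^sup>2) = \<sigma>\<^sup>2"
      using normal_distributed_variance[OF 1(1) d] mean by simp
    moreover have "integrable M (\<lambda>w. exp (X w))"
      using int[of exp] 1(1) by (simp add: exp_times_normal_density)
    moreover have "expectation (\<lambda>w. exp (X w)) = exp (\<sigma>\<^sup>2 / 2)"
      using intg[of exp] 1(1) by (simp add: exp_times_normal_density)
    ultimately show ?thesis using sq by (simp add: has_bochner_integral_iff)
  next
    case (2 c)
    have "expectation X = expectation (\<lambda>_. c)" by (rule integral_cong_AE) (use 2 in auto)
    then have "c = 0" using mean by (simp add: prob_space)
    then have AE: "AE w in M. X w = 0" using 2 by simp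
    have eqs: "integrable M f \<longleftrightarrow> integrable M (\<lambda>_. a)" "integral\<^sup>L M f = integral\<^sup>L M (\<lambda>_. a)"
      if [measurable]: "f \<in> borel_measurable M" and "AE w in M. f w = a" for f :: "'a \<Rightarrow> real" and a
      by (rule integrable_cong_AE integral_cong_AE; use that in simp)+
    have "AE w in M. (X w)\<^sup>2 = 0" "AE w in M. exp (X w) = 1"
      using AE by (auto elim: eventually_mono)
    then show ?thesis
      using eqs[of "\<lambda>w. (X w)\<^sup>2" 0] eqs[of X 0] eqs[of "\<lambda>w. exp (X w)" 1] AE
      by (simp add: has_bochner_integral_iff prob_space)
  qed
  then show "integrable M (\<lambda>w. (X w)\<^sup>2)" "integrable M X"
    "has_bochner_integral M (\<lambda>w. exp (X w)) (exp (expectation (\<lambda>w. (X w)\<^sup>2) / 2))" by blast+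
qed

text \<open>Only the Gaussian structure is recorded here; the decay of \<open>\<gamma>\<close>
  enters with \<open>energy_le_interaction\<close>.\<close>

locale disorder = prob_space P for P :: "'b measure" +
  fixes \<omega> :: "nat \<Rightarrow> 'b \<Rightarrow> real" and \<gamma> :: "int \<Rightarrow> real"
  assumes gauss: "jointly_gaussian P {1..} \<omega>"
    and mean: "\<And>n. n \<ge> 1 \<Longrightarrow> expectation (\<omega> n) = 0"
    and cov: "\<And>n m. n \<ge> 1 \<Longrightarrow> m \<ge> 1 \<Longrightarrow> expectation (\<lambda>w. \<omega> n w * \<omega> m w) = \<gamma> (int n - int m)"
begin

lemma gaussian_sum: "I \<subseteq> {1..} \<Longrightarrow> finite I \<Longrightarrow> gaussian_rv P (\<lambda>w. \<Sum>n\<in>I. c n * \<omega> n w)"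
  using gauss by (simp add: jointly_gaussian_def)

lemma gaussian_component: "n \<ge> 1 \<Longrightarrow> gaussian_rv P (\<omega> n)"
  using gaussian_sum[of "{n}" "\<lambda>_. 1"] by simp

lemma integrable_component: "n \<ge> 1 \<Longrightarrow> integrable P (\<omega> n)"
  using gaussian_rv_centered(2)[OF gaussian_component mean] by simp

lemma integrable_product:
  assumes "n \<ge> 1" "m \<ge> 1"
  shows "integrable P (\<lambda>w. \<omega> n w * \<omega> m w)"
proof (rule Bochner_Integration.integrable_bound)
  note [measurable] = borel_measurable_integrable[OF integrable_component]
  show "integrable P (\<lambda>w. (\<omega> n w)\<^sup>2 + (\<omega> m w)\<^sup>2)"
    using gaussian_rv_centered(1)[OF gaussian_component mean] assms by simp
  show "(\<lambda>w. \<omega> n w * \<omega> m w) \<in> borel_measurable P" using assms by measurable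
  have "\<bar>x * y\<bar> \<le> x\<^sup>2 + y\<^sup>2" for x y :: real
    using sum_squares_bound[of "\<bar>x\<bar>" "\<bar>y\<bar>"] abs_ge_zero[of "x * y"]
    unfolding abs_mult power2_abs mult.assoc by linarith
  then show "AE w in P. norm (\<omega> n w * \<omega> m w) \<le> norm ((\<omega> n w)\<^sup>2 + (\<omega> m w)\<^sup>2)"
    by (simp add: abs_of_nonneg)
qed

lemma cov_sym: "n \<ge> 1 \<Longrightarrow> m \<ge> 1 \<Longrightarrow> \<gamma> (int n - int m) = \<gamma> (int m - int n)"
  using cov[of n m] cov[of m n] by (simp add: mult.commute)

lemma exp_sum:
  assumes I: "I \<subseteq> {1..}" "finite I"
  shows "has_bochner_integral P (\<lambda>w. exp (\<Sum>n\<in>I. c n * \<omega> n w))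
    (exp ((\<Sum>n\<in>I. \<Sum>m\<in>I. c n * c m * \<gamma> (int n - int m)) / 2))"
proof -
  have ge: "n \<ge> 1" if "n \<in> I" for n using I that by auto
  have "expectation (\<lambda>w. \<Sum>n\<in>I. c n * \<omega> n w) = 0"
    using ge by (subst Bochner_Integration.integral_sum) (auto simp: mean integrable_component)
  from gaussian_rv_centered(3)[OF gaussian_sum[OF I] this]
  have "has_bochner_integral P (\<lambda>w. exp (\<Sum>n\<in>I. c n * \<omega> n w))
    (exp (expectation (\<lambda>w. (\<Sum>n\<in>I. c n * \<omega> n w)\<^sup>2) / 2))" .
  moreover have "expectation (\<lambda>w. (\<Sum>n\<in>I. c n * \<omega> n w)\<^sup>2)
      = expectation (\<lambda>w. \<Sum>n\<in>I. \<Sum>m\<in>I. c n * c m * (\<omega> n w * \<omega> m w))"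
    by (simp add: power2_eq_square sum_product mult_ac)
  moreover have "\<dots> = (\<Sum>n\<in>I. \<Sum>m\<in>I. c n * c m * \<gamma> (int n - int m))"
    using ge by (simp add: Bochner_Integration.integral_sum integrable_product cov)
  ultimately show ?thesis by simp
qed

definition energy :: "nat set \<Rightarrow> nat set \<Rightarrow> real" where
  "energy S S' = (\<Sum>n\<in>S. \<Sum>m\<in>S'. \<gamma> (int n - int m))"

definition wick :: "real \<Rightarrow> nat set \<Rightarrow> 'b \<Rightarrow> real" where
  "wick \<beta> S w = exp (\<beta> * (\<Sum>n\<in>S. \<omega> n w) - 1 / 2 * \<beta>\<^sup>2 * energy S S)"

lemma wick_pos: "wick \<beta> S w > 0"
  by (simp add: wick_def)

lemma energy_sym:
  assumes "S \<subseteq> {1..}" "S' \<subseteq> {1..}"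
  shows "energy S S' = energy S' S"
proof -
  have "energy S S' = (\<Sum>m\<in>S'. \<Sum>n\<in>S. \<gamma> (int n - int m))"
    unfolding energy_def by (rule sum.swap)
  also have "\<dots> = energy S' S"
    unfolding energy_def using assms by (intro sum.cong refl cov_sym) auto
  finally show ?thesis .
qed

lemma wick_mean:
  assumes "S \<subseteq> {1..}" "finite S"
  shows "has_bochner_integral P (wick \<beta> S) 1"
proof -
  have "has_bochner_integral P (\<lambda>w. exp (\<Sum>n\<in>S. \<beta> * \<omega> n w)) (exp (\<beta>\<^sup>2 * energy S S / 2))"
    using exp_sum[OF assms, of "\<lambda>_. \<beta>"]
    by (simp add: energy_def power2_eq_square sum_distrib_left)
  then have "has_bochner_integral P
      (\<lambda>w. exp (\<Sum>n\<in>S. \<beta> * \<omega> n w) * exp (- (\<beta>\<^sup>2 * energy S S / 2)))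
      (exp (\<beta>\<^sup>2 * energy S S / 2) * exp (- (\<beta>\<^sup>2 * energy S S / 2)))"
    by (rule has_bochner_integral_mult_left)
  moreover have "exp (\<Sum>n\<in>S. \<beta> * \<omega> n w) * exp (- (\<beta>\<^sup>2 * energy S S / 2)) = wick \<beta> S w" for w
    unfolding mult_exp_exp wick_def by (simp add: sum_distrib_left)
  ultimately show ?thesis by (simp add: mult_exp_exp)
qed

text \<open>The product is, up to normalisation, the exponential of one Gaussian sum whose variance
  contains both self-energies and twice the mutual energy; the Wick corrections cancel the
  self-energies.\<close>

lemma wick_product:
  assumes S: "S \<subseteq> {1..}" "finite S" and S': "S' \<subseteq> {1..}" "finite S'"
  shows "has_bochner_integral P (\<lambda>w. wick \<beta> S w * wick \<beta> S' w) (exp (\<beta>\<^sup>2 * energy S S'))"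
proof -
  \<comment> \<open>Points common to \<open>S\<close> and \<open>S'\<close> carry the weight
    \<open>2 * \<beta>\<close>.\<close>
  let ?I = "S \<union> S'" and ?c = "\<lambda>n. \<beta> * (indicator S n + indicator S' n)"
  have ind: "(\<Sum>n\<in>?I. indicator A n * f n) = (\<Sum>n\<in>A. f n)" if "A \<subseteq> ?I" for A and f :: "nat \<Rightarrow> real"
    using that S S' by (intro sum.mono_neutral_cong_right) (auto simp: indicator_def)
  have lin: "(\<Sum>n\<in>?I. ?c n * \<omega> n w) = \<beta> * (\<Sum>n\<in>S. \<omega> n w) + \<beta> * (\<Sum>n\<in>S'. \<omega> n w)" for w
  proof -
    have "(\<Sum>n\<in>?I. ?c n * \<omega> n w)
        = \<beta> * (\<Sum>n\<in>?I. indicator S n * \<omega> n w) + \<beta> * (\<Sum>n\<in>?I. indicator S' n * \<omega> n w)"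
      by (simp only: distrib_left distrib_right sum.distrib sum_distrib_left mult.assoc)
    then show ?thesis by (simp only: ind Un_upper1 Un_upper2)
  qed
  have quad: "(\<Sum>n\<in>?I. \<Sum>m\<in>?I. indicator A n * indicator B m * \<gamma> (int n - int m)) = energy A B"
    if "A \<subseteq> ?I" "B \<subseteq> ?I" for A B
  proof -
    have "(\<Sum>n\<in>?I. \<Sum>m\<in>?I. indicator A n * indicator B m * \<gamma> (int n - int m))
        = (\<Sum>n\<in>?I. indicator A n * (\<Sum>m\<in>?I. indicator B m * \<gamma> (int n - int m)))"
      by (simp only: mult.assoc sum_distrib_left)
    then show ?thesis by (simp only: ind that energy_def)
  qed
  have "(\<Sum>n\<in>?I. \<Sum>m\<in>?I. ?c n * ?c m * \<gamma> (int n - int m))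
      = \<beta>\<^sup>2 * (\<Sum>n\<in>?I. \<Sum>m\<in>?I. indicator S n * indicator S m * \<gamma> (int n - int m)
          + indicator S n * indicator S' m * \<gamma> (int n - int m)
          + indicator S' n * indicator S m * \<gamma> (int n - int m)
          + indicator S' n * indicator S' m * \<gamma> (int n - int m))"
    unfolding sum_distrib_left
    by (intro sum.cong refl) (simp add: algebra_simps power2_eq_square)
  also have "\<dots> = \<beta>\<^sup>2 * (energy S S + energy S S' + energy S' S + energy S' S')"
    by (simp only: sum.distrib quad Un_upper1 Un_upper2)
  finally have quad_c: "(\<Sum>n\<in>?I. \<Sum>m\<in>?I. ?c n * ?c m * \<gamma> (int n - int m)) / 2
      = \<beta>\<^sup>2 * energy S S' + 1 / 2 * \<beta>\<^sup>2 * energy S S + 1 / 2 * \<beta>\<^sup>2 * energy S' S'"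
    using energy_sym[OF S(1) S'(1)] by (simp add: algebra_simps)
  have "has_bochner_integral P (\<lambda>w. exp (\<Sum>n\<in>?I. ?c n * \<omega> n w))
      (exp ((\<Sum>n\<in>?I. \<Sum>m\<in>?I. ?c n * ?c m * \<gamma> (int n - int m)) / 2))"
    using S S' by (intro exp_sum) auto
  then have "has_bochner_integral P
      (\<lambda>w. exp (\<Sum>n\<in>?I. ?c n * \<omega> n w) * exp (- (1 / 2 * \<beta>\<^sup>2 * energy S S + 1 / 2 * \<beta>\<^sup>2 * energy S' S')))
      (exp ((\<Sum>n\<in>?I. \<Sum>m\<in>?I. ?c n * ?c m * \<gamma> (int n - int m)) / 2)
        * exp (- (1 / 2 * \<beta>\<^sup>2 * energy S S + 1 / 2 * \<beta>\<^sup>2 * energy S' S')))"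
    by (rule has_bochner_integral_mult_left)
  moreover have "exp (\<Sum>n\<in>?I. ?c n * \<omega> n w) * exp (- (1 / 2 * \<beta>\<^sup>2 * energy S S + 1 / 2 * \<beta>\<^sup>2 * energy S' S'))
      = wick \<beta> S w * wick \<beta> S' w" for w
    unfolding lin wick_def mult_exp_exp by simp
  moreover have "exp ((\<Sum>n\<in>?I. \<Sum>m\<in>?I. ?c n * ?c m * \<gamma> (int n - int m)) / 2)
        * exp (- (1 / 2 * \<beta>\<^sup>2 * energy S S + 1 / 2 * \<beta>\<^sup>2 * energy S' S'))
      = exp (\<beta>\<^sup>2 * energy S S')"
    unfolding quad_c mult_exp_exp by simp
  ultimately show ?thesis by simp
qed

end

text \<open>Each \<open>W S\<close> is a probability density; the minimum is Markov's inequality for \<open>Z\<close> under it.\<close>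

lemma (in prob_space) mixture_tail:
  fixes W :: "'i \<Rightarrow> 'a \<Rightarrow> real"
  assumes A: "finite A" and w: "\<And>S. S \<in> A \<Longrightarrow> w S \<ge> 0"
    and W0: "\<And>S x. S \<in> A \<Longrightarrow> W S x \<ge> 0"
    and W1: "\<And>S. S \<in> A \<Longrightarrow> has_bochner_integral M (W S) 1"
    and W2: "\<And>S S'. S \<in> A \<Longrightarrow> S' \<in> A \<Longrightarrow> has_bochner_integral M (\<lambda>x. W S x * W S' x) (c S S')"
    and K: "K > 0"
  defines "Z \<equiv> \<lambda>x. \<Sum>S\<in>A. w S * W S x"
  shows "(\<integral>\<^sup>+ x. ennreal \<bar>Z x\<bar> * indicator {x. \<bar>Z x\<bar> > K} x \<partial>M)
    \<le> ennreal (\<Sum>S\<in>A. w S * min 1 ((\<Sum>S'\<in>A. w S' * c S S') / K))"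
proof -
  have Z0: "Z x \<ge> 0" for x unfolding Z_def using w W0 by (intro sum_nonneg) auto
  have intW: "integrable M (W S)" "expectation (W S) = 1" if "S \<in> A" for S
    using W1[OF that] by (auto simp: has_bochner_integral_iff)
  have intWW: "integrable M (\<lambda>x. W S x * W S' x)" "expectation (\<lambda>x. W S x * W S' x) = c S S'"
    if "S \<in> A" "S' \<in> A" for S S'
    using W2[OF that] by (auto simp: has_bochner_integral_iff)
  have [measurable]: "Z \<in> borel_measurable M"
    unfolding Z_def using intW by (intro borel_measurable_sum borel_measurable_times) auto
  define H where "H = {x\<in>space M. Z x > K}"
  have [measurable]: "H \<in> events" unfolding H_def by measurable
  have intH: "integrable M (\<lambda>x. W S x * indicator H x)" if "S \<in> A" for S
    using integrable_mult_indicator[OF _ intW(1)[OF that], of H] by (simp add: mult.commute)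
  have bd: "expectation (\<lambda>x. W S x * indicator H x) \<le> min 1 ((\<Sum>S'\<in>A. w S' * c S S') / K)"
    if S: "S \<in> A" for S
  proof -
    have "expectation (\<lambda>x. W S x * indicator H x) \<le> expectation (W S)"
      using W0[OF S] by (intro integral_mono intH S intW) (auto simp: indicator_def)
    moreover have "expectation (\<lambda>x. W S x * indicator H x) \<le> expectation (\<lambda>x. \<Sum>S'\<in>A. w S' / K * (W S x * W S' x))"
    proof (intro integral_mono intH S Bochner_Integration.integrable_sum integrable_mult_right intWW)
      fix x assume "x \<in> space M"
      have "W S x * indicator H x \<le> W S x * (Z x / K)"
        using W0[OF S] Z0[of x] K
        by (intro mult_left_mono) (auto simp: H_def indicator_def divide_simps)
      also have "\<dots> = (\<Sum>S'\<in>A. w S' / K * (W S x * W S' x))"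
        by (simp add: Z_def sum_distrib_left sum_divide_distrib mult_ac)
      finally show "W S x * indicator H x \<le> (\<Sum>S'\<in>A. w S' / K * (W S x * W S' x))" .
    qed auto
    moreover have "expectation (\<lambda>x. \<Sum>S'\<in>A. w S' / K * (W S x * W S' x)) = (\<Sum>S'\<in>A. w S' * c S S') / K"
      using S by (simp add: Bochner_Integration.integral_sum intWW sum_divide_distrib)
    ultimately show ?thesis using intW(2)[OF S] by simp
  qed
  have "(\<integral>\<^sup>+ x. ennreal \<bar>Z x\<bar> * indicator {x. \<bar>Z x\<bar> > K} x \<partial>M)
      = (\<integral>\<^sup>+ x. ennreal (\<Sum>S\<in>A. w S * (W S x * indicator H x)) \<partial>M)"
  proof (rule nn_integral_cong)
    fix x assume "x \<in> space M"
    then show "ennreal \<bar>Z x\<bar> * indicator {x. \<bar>Z x\<bar> > K} x = ennreal (\<Sum>S\<in>A. w S * (W S x * indicator H x))"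
      using Z0[of x] by (simp add: H_def indicator_def) (simp add: Z_def)
  qed
  also have "\<dots> = ennreal (expectation (\<lambda>x. \<Sum>S\<in>A. w S * (W S x * indicator H x)))"
    using w W0 by (intro nn_integral_eq_integral Bochner_Integration.integrable_sum integrable_mult_right intH)
      (auto intro!: sum_nonneg)
  also have "expectation (\<lambda>x. \<Sum>S\<in>A. w S * (W S x * indicator H x))
      = (\<Sum>S\<in>A. w S * expectation (\<lambda>x. W S x * indicator H x))"
    by (simp add: Bochner_Integration.integral_sum intH)
  also have "\<dots> \<le> (\<Sum>S\<in>A. w S * min 1 ((\<Sum>S'\<in>A. w S' * c S S') / K))"
    using bd w by (intro sum_mono mult_left_mono) auto
  finally show ?thesis by (simp add: ennreal_leI)
qed

section \<open>Uniform integrability\<close>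

lemma eventually_le_imp_bounded:
  fixes f :: "nat \<Rightarrow> real"
  assumes "\<forall>\<^sub>F n in sequentially. f n \<le> B"
  obtains B' where "\<And>n. f n \<le> B'"
proof -
  obtain N where N: "\<And>n. n \<ge> N \<Longrightarrow> f n \<le> B"
    using assms by (auto simp: eventually_sequentially)
  have "f n \<le> max B (Max (f ` {..N}))" for n
  proof (cases "n \<le> N")
    case True
    then have "f n \<le> Max (f ` {..N})" by (intro Max_ge) auto
    then show ?thesis by simp
  next
    case False
    then show ?thesis using N[of n] by simp
  qed
  then show thesis by (rule that)
qed

text \<open>This plays the role of the Cauchy-Schwarz inequality in separating a tilt
  \<open>x\<close> from the indicator of rare sets: the square has a bounded moment, and the
  constant meets a small probability.\<close>

lemma le_scaled_square_plus:
  fixes x :: real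
  assumes "\<delta> > 0"
  shows "x \<le> \<delta> * x\<^sup>2 + 1 / \<delta>"
proof -
  have "0 \<le> (\<delta> * x - 1 / 2)\<^sup>2" by simp
  then have "\<delta> * x \<le> \<delta> * (\<delta> * x\<^sup>2) + 1"
    by (simp add: power2_eq_square algebra_simps)
  then have "\<delta> * x / \<delta> \<le> (\<delta> * (\<delta> * x\<^sup>2) + 1) / \<delta>"
    using assms by (intro divide_right_mono) auto
  then show ?thesis using assms by (simp add: add_divide_distrib)
qed

context regular_renewal
begin

text \<open>A set \<open>S\<close> is bad when its potential exceeds \<open>D * K1\<close>
  somewhere. For good \<open>S\<close> the exponential moments of \<open>card S'\<close> bound the
  inner sum by a constant; for bad \<open>S\<close> the minimum is replaced by 1 and the tilt is
  split off by \<open>le_scaled_square_plus\<close>. The function \<open>e\<close> stands for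
  \<open>\<beta>\<^sup>2\<close> times the mutual energy.\<close>

lemma tilted_tail_small:
  assumes s: "s \<ge> 0" "\<kappa> + s < 1" and c: "c1 \<ge> 0" "c2 \<ge> 0" and \<eta>: "\<eta> > 0"
  obtains K0 where "K0 > 0"
    "\<And>K N h e. \<lbrakk>K \<ge> K0; N \<ge> 1; \<bar>h\<bar> \<le> c1 * b N;
        \<And>S S'. S \<subseteq> {1..N} \<Longrightarrow> S' \<subseteq> {1..N} \<Longrightarrow>
          e S S' \<le> c2 * (b N)\<^sup>2 * real N powr s * (\<Sum>m\<in>S'. interaction s S m)\<rbrakk>
      \<Longrightarrow> (\<Sum>S\<in>Pow {1..N}. q N S * exp (h * real (card S)) *
            min 1 ((\<Sum>S'\<in>Pow {1..N}. q N S' * exp (h * real (card S')) * exp (e S S')) / K)) \<le> \<eta>"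
proof -
  obtain \<Phi>1' where \<Phi>1': "\<And>N. N \<ge> 1 \<Longrightarrow> (\<Sum>S\<in>Pow {1..N}. q N S * exp (2 * c1 * b N * real (card S))) \<le> \<Phi>1'"
    by (rule exp_moment_bounded[of "2 * c1"]) (use c in auto)
  define \<Phi>1 where "\<Phi>1 = max 1 \<Phi>1'"
  have \<Phi>1: "(\<Sum>S\<in>Pow {1..N}. q N S * exp (2 * c1 * b N * real (card S))) \<le> \<Phi>1" if "N \<ge> 1" for N
    using \<Phi>1'[OF that] by (simp add: \<Phi>1_def)
  have \<Phi>1_pos: "\<Phi>1 > 0" by (simp add: \<Phi>1_def)
  obtain D where D: "D > 0" "\<And>K N. K \<ge> 1 \<Longrightarrow> N \<ge> 1 \<Longrightarrow>
      (\<Sum>S | S \<subseteq> {1..N} \<and> (\<exists>n\<in>{1..N}. b N * real N powr s * interaction s S n > D * K). q N S) \<le> D / K"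
    by (rule interaction_tight[OF s]) blast
  \<comment> \<open>Each parameter takes a third of \<open>\<eta>\<close>: \<open>\<delta>\<close>
    for the squared tilt, \<open>K1\<close> for the probability of bad sets, \<open>K0\<close> for
    good sets. The bound \<open>\<Phi>2\<close> depends on \<open>K1\<close>, so \<open>K0\<close>
    comes last.\<close>
  define \<delta> where "\<delta> = \<eta> / (3 * \<Phi>1)"
  have \<delta>: "\<delta> > 0" using \<eta> \<Phi>1_pos by (simp add: \<delta>_def)
  define K1 where "K1 = max 1 (3 * D / (\<delta> * \<eta>))"
  have K1: "K1 \<ge> 1" "D / K1 / \<delta> \<le> \<eta> / 3"
  proof -
    show "K1 \<ge> 1" by (simp add: K1_def)
    have "3 * D / (\<delta> * \<eta>) \<le> K1" by (simp add: K1_def)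
    then have "3 * D \<le> K1 * (\<delta> * \<eta>)" using \<delta> \<eta> by (simp add: divide_le_eq)
    then show "D / K1 / \<delta> \<le> \<eta> / 3" using \<delta> \<open>K1 \<ge> 1\<close> by (simp add: divide_le_eq mult_ac)
  qed
  obtain \<Phi>2' where \<Phi>2': "\<And>N. N \<ge> 1 \<Longrightarrow> (\<Sum>S\<in>Pow {1..N}. q N S * exp ((c1 + c2 * D * K1) * b N * real (card S))) \<le> \<Phi>2'"
    by (rule exp_moment_bounded[of "c1 + c2 * D * K1"]) (use c D K1 in auto)
  define \<Phi>2 where "\<Phi>2 = max 1 \<Phi>2'"
  have \<Phi>2: "(\<Sum>S\<in>Pow {1..N}. q N S * exp ((c1 + c2 * D * K1) * b N * real (card S))) \<le> \<Phi>2" if "N \<ge> 1" for N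
    using \<Phi>2'[OF that] by (simp add: \<Phi>2_def)
  have \<Phi>2_pos: "\<Phi>2 > 0" by (simp add: \<Phi>2_def)
  define K0 where "K0 = 3 * \<Phi>1 * \<Phi>2 / \<eta>"
  have K0: "K0 > 0" using \<eta> \<Phi>1_pos \<Phi>2_pos by (simp add: K0_def)
  have "(\<Sum>S\<in>Pow {1..N}. q N S * exp (h * real (card S)) *
            min 1 ((\<Sum>S'\<in>Pow {1..N}. q N S' * exp (h * real (card S')) * exp (e S S')) / K)) \<le> \<eta>"
    if K: "K \<ge> K0" and N: "N \<ge> 1" and h: "\<bar>h\<bar> \<le> c1 * b N"
      and e: "\<And>S S'. S \<subseteq> {1..N} \<Longrightarrow> S' \<subseteq> {1..N} \<Longrightarrow>
          e S S' \<le> c2 * (b N)\<^sup>2 * real N powr s * (\<Sum>m\<in>S'. interaction s S m)" for K N h e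
  proof -
    define bad where "bad S \<longleftrightarrow> (\<exists>n\<in>{1..N}. b N * real N powr s * interaction s S n > D * K1)" for S
    have Kpos: "K > 0" using K K0 by linarith
    have bN: "b N > 0" by (rule b_pos[OF N])
    have h_le: "h * real (card S) \<le> c1 * b N * real (card S)" for S :: "nat set"
      using h by (intro mult_right_mono) auto
    define G where "G S = (\<Sum>S'\<in>Pow {1..N}. q N S' * exp (h * real (card S')) * exp (e S S'))" for S
    have G_good: "G S \<le> \<Phi>2" if S: "S \<subseteq> {1..N}" "\<not> bad S" for S
    proof -
      have "G S \<le> (\<Sum>S'\<in>Pow {1..N}. q N S' * exp ((c1 + c2 * D * K1) * b N * real (card S')))"
        unfolding G_def
      proof (intro sum_mono)
        fix S' assume S': "S' \<in> Pow {1..N}"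
        have "e S S' \<le> c2 * (b N)\<^sup>2 * real N powr s * (\<Sum>m\<in>S'. interaction s S m)"
          using S S' by (intro e) auto
        also have "\<dots> = c2 * b N * (\<Sum>m\<in>S'. b N * real N powr s * interaction s S m)"
          by (simp add: power2_eq_square sum_distrib_left mult_ac)
        also have "\<dots> \<le> c2 * b N * (\<Sum>m\<in>S'. D * K1)"
          using S S' c bN by (intro mult_left_mono sum_mono) (auto simp: bad_def not_less)
        also have "\<dots> = c2 * D * K1 * b N * real (card S')" by simp
        finally have "h * real (card S') + e S S' \<le> (c1 + c2 * D * K1) * b N * real (card S')"
          using h_le[of S'] by (simp add: algebra_simps)
        then have "exp (h * real (card S')) * exp (e S S') \<le> exp ((c1 + c2 * D * K1) * b N * real (card S'))"
          by (simp add: mult_exp_exp)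
        then show "q N S' * exp (h * real (card S')) * exp (e S S')
            \<le> q N S' * exp ((c1 + c2 * D * K1) * b N * real (card S'))"
          using q_nonneg[of N S'] by (simp add: mult.assoc mult_left_mono)
      qed
      also have "\<dots> \<le> \<Phi>2" by (rule \<Phi>2[OF N])
      finally show ?thesis .
    qed
    \<comment> \<open>Allowing \<open>\<delta>\<close> for good sets too gives one bound for both
      cases, whose first part sums to an exponential moment of twice the tilt.\<close>
    have term_le: "q N S * exp (h * real (card S)) * min 1 (G S / K)
        \<le> q N S * exp (2 * c1 * b N * real (card S)) * (\<Phi>2 / K + \<delta>) + (if bad S then q N S else 0) / \<delta>"
      if S: "S \<subseteq> {1..N}" for S
    proof -
      let ?u = "exp (c1 * b N * real (card S))"
      have u1: "?u \<ge> 1" using c bN by simp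
      have hu: "exp (h * real (card S)) \<le> ?u" using h_le[of S] by simp
      have u2: "?u\<^sup>2 = exp (2 * c1 * b N * real (card S))"
        by (simp add: power2_eq_square mult_exp_exp)
      have uu: "?u \<le> ?u\<^sup>2" using u1 by (rule self_le_power) simp
      have "exp (h * real (card S)) * min 1 (G S / K) \<le> ?u\<^sup>2 * (\<Phi>2 / K + \<delta>) + (if bad S then 1 else 0) / \<delta>"
      proof (cases "bad S")
        case True
        have "exp (h * real (card S)) * min 1 (G S / K) \<le> exp (h * real (card S)) * 1"
          by (intro mult_left_mono) auto
        also have "\<dots> \<le> ?u" using hu by simp
        also have "\<dots> \<le> \<delta> * ?u\<^sup>2 + 1 / \<delta>" by (rule le_scaled_square_plus[OF \<delta>])
        also have "\<dots> \<le> ?u\<^sup>2 * (\<Phi>2 / K + \<delta>) + 1 / \<delta>"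
          using \<Phi>2_pos Kpos by (simp add: algebra_simps)
        finally show ?thesis using True by simp
      next
        case False
        have "exp (h * real (card S)) * min 1 (G S / K) \<le> exp (h * real (card S)) * (\<Phi>2 / K)"
          using G_good[OF S False] Kpos by (intro mult_left_mono) (auto simp: min_le_iff_disj divide_right_mono)
        also have "\<dots> \<le> ?u\<^sup>2 * (\<Phi>2 / K + \<delta>)"
          using order_trans[OF hu uu] \<Phi>2_pos Kpos \<delta> by (intro mult_mono) auto
        finally show ?thesis using False by simp
      qed
      from mult_left_mono[OF this q_nonneg[of N S]] show ?thesis
        unfolding u2 by (simp add: algebra_simps split: if_splits)
    qed
    have "(\<Sum>S\<in>Pow {1..N}. q N S * exp (h * real (card S)) * min 1 (G S / K))
      \<le> (\<Sum>S\<in>Pow {1..N}. q N S * exp (2 * c1 * b N * real (card S)) * (\<Phi>2 / K + \<delta>) + (if bad S then q N S else 0) / \<delta>)"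
      using term_le by (intro sum_mono) auto
    also have "\<dots> = (\<Sum>S\<in>Pow {1..N}. q N S * exp (2 * c1 * b N * real (card S))) * (\<Phi>2 / K + \<delta>)
        + (\<Sum>S | S \<subseteq> {1..N} \<and> bad S. q N S) / \<delta>"
      by (simp add: sum.distrib sum_distrib_right sum_divide_distrib[symmetric] sum.inter_filter[symmetric] Pow_def)
    also have "\<dots> \<le> \<Phi>1 * (\<Phi>2 / K + \<delta>) + D / K1 / \<delta>"
      using \<Phi>1[OF N] D(2)[OF K1(1) N] \<Phi>2_pos Kpos \<delta>
      by (intro add_mono mult_right_mono divide_right_mono) (auto simp: bad_def)
    also have "\<Phi>1 * (\<Phi>2 / K + \<delta>) \<le> \<eta> / 3 + \<eta> / 3"
    proof -
      have "3 * \<Phi>1 * \<Phi>2 \<le> K * \<eta>" using K \<eta> by (simp add: K0_def divide_le_eq)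
      then have "\<Phi>1 * \<Phi>2 / K \<le> \<eta> / 3" using Kpos by (simp add: divide_le_eq mult_ac)
      moreover have "\<Phi>1 * \<delta> = \<eta> / 3" using \<Phi>1_pos by (simp add: \<delta>_def)
      ultimately show ?thesis by (simp add: distrib_left)
    qed
    finally show ?thesis using K1(2) unfolding G_def by linarith
  qed
  then show thesis using K0 by (rule that[rotated])
qed

end

section \<open>The three scalings measured by \<open>b\<close>\<close>

definition critical_scale :: "real \<Rightarrow> (real \<Rightarrow> real) \<Rightarrow> ennreal \<Rightarrow> nat \<Rightarrow> real" where
  "critical_scale \<alpha> L \<mu> N =
     (if \<alpha> < 1 then L (real N) * real N powr - \<alpha>
      else if \<mu> < \<infinity> then real N powr - 1
      else log_partial_sum L N * real N powr - 1)"

lemma pinning_scaling_eq: "pinning_scaling \<alpha> L \<mu> h0 N = h0 * critical_scale \<alpha> L \<mu> N"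
  by (simp add: pinning_scaling_def critical_scale_def)

lemma disorder_scaling_eq:
  "disorder_scaling \<alpha> H L \<mu> \<beta>0 N = \<beta>0 * critical_scale \<alpha> L \<mu> N * real N powr (1 - H)"
proof -
  have "real N powr (- (\<alpha> + H - 1)) = real N powr - \<alpha> * real N powr (1 - H)"
    "real N powr - H = real N powr - 1 * real N powr (1 - H)"
    unfolding powr_add[symmetric] by (simp_all add: algebra_simps)
  then show ?thesis
    by (simp only: disorder_scaling_def critical_scale_def mult.assoc split: if_split) simp
qed

text \<open>Summation by parts: the two sides differ by the nonnegative boundary term
  \<open>N * F N\<close>.\<close>

lemma (in tail) sum_first_moment_le:
  assumes "\<And>k. F k - F (Suc k) = p (Suc k)"
  shows "(\<Sum>n=1..N. real n * p n) \<le> m N"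
proof -
  have "(\<Sum>n=1..N. real n * p n) = m N - real N * F N"
  proof (induction N)
    case (Suc N)
    have "F N = F (Suc N) + p (Suc N)" using assms[of N] by simp
    then show ?case using Suc by (simp add: truncated_mean_def algebra_simps)
  qed (simp add: truncated_mean_def)
  then show ?thesis using nonneg[of N] by simp
qed

text \<open>A distance \<open>d \<ge> 1\<close> is at least \<open>(d + 1) / 2\<close>, and the
  halving costs the factor \<open>2 powr (2 - 2 * H)\<close>; on the diagonal this factor is at
  least 1.\<close>

lemma correlation_bound_le:
  assumes "H < 1"
  shows "correlation_bound H (int n - int m) \<le> 2 powr (2 - 2 * H) * (\<bar>real n - real m\<bar> + 1) powr - (2 - 2 * H)"
proof -
  define d where "d = \<bar>real n - real m\<bar>"
  have dd: "\<bar>real_of_int (int n - int m)\<bar> = d" by (simp add: d_def)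
  show ?thesis
  proof (cases "n = m")
    case True
    then show ?thesis using assms ge_one_powr_ge_zero[of 2 "2 - 2 * H"] by (simp add: correlation_bound_def)
  next
    case False
    then have "d \<ge> 1" by (cases "n < m") (auto simp: d_def)
    have "correlation_bound H (int n - int m) \<le> d powr (2 * H - 2)"
      unfolding correlation_bound_def dd using False by simp
    also have "\<dots> \<le> ((d + 1) / 2) powr (2 * H - 2)"
      using \<open>d \<ge> 1\<close> assms by (intro powr_mono2') auto
    also have "\<dots> = (d + 1) powr (2 * H - 2) / 2 powr (2 * H - 2)"
      using \<open>d \<ge> 1\<close> by (simp add: powr_divide)
    also have "\<dots> = 2 powr (2 - 2 * H) * (d + 1) powr - (2 - 2 * H)"
      using powr_minus_divide[of 2 "2 * H - 2"] by simp
    finally show ?thesis by (simp add: d_def)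
  qed
qed

context renewal
begin

lemma F_diff: "F k - F (Suc k) = prob {x \<in> space M. \<xi> 0 x = enat (Suc k)}"
proof -
  have "enat k < e \<longleftrightarrow> enat (Suc k) < e \<or> e = enat (Suc k)" for e
    by (cases e) auto
  then have "{x \<in> space M. enat k < \<xi> 0 x} =
      {x \<in> space M. enat (Suc k) < \<xi> 0 x} \<union> {x \<in> space M. \<xi> 0 x = enat (Suc k)}"
    by blast
  then have "F k = F (Suc k) + prob {x \<in> space M. \<xi> 0 x = enat (Suc k)}"
    unfolding F_def by (simp only:) (rule finite_measure_Union, auto)
  then show ?thesis by simp
qed

lemma F_tendsto: "F \<longlonglongrightarrow> prob {x \<in> space M. \<xi> 0 x = \<infinity>}"
proof -
  have "(\<Inter>k. {x \<in> space M. enat k < \<xi> 0 x}) = {x \<in> space M. \<xi> 0 x = \<infinity>}"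
  proof safe
    fix x assume x: "x \<in> (\<Inter>k. {x \<in> space M. enat k < \<xi> 0 x})"
    then show "x \<in> space M" by auto
    show "\<xi> 0 x = \<infinity>"
    proof (rule ccontr)
      assume "\<xi> 0 x \<noteq> \<infinity>"
      then obtain k where "\<xi> 0 x = enat k" by auto
      then show False using x by force
    qed
  qed auto
  moreover have "(\<lambda>k. prob {x \<in> space M. enat k < \<xi> 0 x})
      \<longlonglongrightarrow> prob (\<Inter>k. {x \<in> space M. enat k < \<xi> 0 x})"
  proof (rule finite_Lim_measure_decseq)
    show "decseq (\<lambda>k. {x \<in> space M. enat k < \<xi> 0 x})"
      unfolding decseq_def by safe (meson enat_ord_simps(1) le_less_trans)
  qed auto
  ultimately show ?thesis unfolding F_def by simp
qed

lemma mean_finite_if_bounded: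
  assumes "\<And>n. m n \<le> B"
  shows "(\<integral>\<^sup>+ x. ennreal_of_enat (\<xi> 0 x) \<partial>M) < \<infinity>"
proof -
  have "(\<integral>\<^sup>+ x. ennreal_of_enat (\<xi> 0 x) \<partial>M) = (\<Sum>t. emeasure M {x \<in> space M. enat t < \<xi> 0 x})"
    by (rule nn_integral_enat_function) measurable
  also have "\<dots> = (\<Sum>t. ennreal (F t))"
    by (simp add: F_def emeasure_eq_measure)
  also have "\<dots> = (SUP n. \<Sum>t<n. ennreal (F t))" by (rule suminf_eq_SUP)
  also have "\<dots> \<le> ennreal B"
  proof (rule SUP_least)
    fix n
    have "(\<Sum>t<n. ennreal (F t)) = ennreal (m n)"
      unfolding truncated_mean_def by (rule sum_ennreal) (rule nonneg)
    also have "\<dots> \<le> ennreal B" by (intro ennreal_leI assms)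
    finally show "(\<Sum>t<n. ennreal (F t)) \<le> ennreal B" .
  qed
  also have "\<dots> < \<infinity>" by simp
  finally show ?thesis .
qed

end

locale regular_law = renewal +
  fixes L :: "real \<Rightarrow> real" and \<alpha> :: real
  assumes sv: "slowly_varying L" and \<alpha>: "\<alpha> > 0"
    and law: "\<And>n. n \<ge> 1 \<Longrightarrow> prob {x \<in> space M. \<xi> 0 x = enat n} = L (real n) / real n powr (1 + \<alpha>)"
    and proper: "prob {x \<in> space M. \<xi> 0 x < \<infinity>} = 1"
begin

definition p :: "nat \<Rightarrow> real" where
  "p n = prob {x \<in> space M. \<xi> 0 x = enat n}"

lemma p_eq: "n \<ge> 1 \<Longrightarrow> p n = L (real n) / real n powr (1 + \<alpha>)"
  unfolding p_def by (rule law)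

lemma p_nonneg: "p n \<ge> 0"
  by (simp add: p_def)

lemma F_step: "F k - F (Suc k) = p (Suc k)"
  unfolding p_def by (rule F_diff)

lemma F_tendsto_0: "F \<longlonglongrightarrow> 0"
proof -
  have "prob {x \<in> space M. \<xi> 0 x = \<infinity>} = 1 - prob {x \<in> space M. \<xi> 0 x < \<infinity>}"
    by (subst prob_compl[symmetric]) (auto intro!: arg_cong[where f = prob])
  then show ?thesis using F_tendsto proper by simp
qed

lemma halving: "\<rho> > 2 powr - \<alpha> \<Longrightarrow> \<forall>\<^sub>F j in sequentially. F (2 * j) \<le> \<rho> * F j"
  by (rule regular_tail_halving[OF sv p_eq \<alpha> _ F_step F_tendsto_0])

lemma log_partial_sum_le:
  assumes "\<alpha> = 1"
  shows "log_partial_sum L N \<le> m N"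
proof -
  have "log_partial_sum L N = (\<Sum>n=1..N. real n * p n)"
    unfolding log_partial_sum_def
    by (intro sum.cong refl) (simp add: p_eq assms power2_eq_square)
  then show ?thesis using sum_first_moment_le[OF F_step] by simp
qed

text \<open>By slow variation each \<open>n * p n\<close> with \<open>n\<close> in the upper half of
  \<open>{1..N}\<close> is at least \<open>L N * N powr - \<alpha> / exp 1\<close>. There are at
  least N/2 such terms, which bounds \<open>m N\<close> from below.\<close>

lemma eventually_regular_scale_le:
  "\<forall>\<^sub>F N in sequentially. L (real N) * real N powr - \<alpha> / b N \<le> 2 * exp 1"
proof -
  obtain X where X: "\<And>x. x \<ge> X \<Longrightarrow> \<forall>y\<in>{x..2*x}. L y \<le> exp 1 * L x"
    using slowly_varying_le_exp[OF sv, of 1] by (auto simp: eventually_at_top_linorder)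
  have "\<forall>\<^sub>F N in sequentially. N \<ge> max 1 (2 * nat \<lceil>X\<rceil>)" by (rule eventually_ge_at_top)
  then show ?thesis
  proof eventually_elim
    case (elim N)
    then have N: "N \<ge> 1" "real N \<ge> 2 * X" by linarith+
    let ?u = "L (real N) * real N powr - \<alpha>"
    have LN: "L (real N) > 0" using N by (intro slowly_varying_pos[OF sv]) simp
    have n_p: "?u / exp 1 \<le> real n * p n" if n: "n \<in> {(N + 1) div 2..N}" for n
    proof -
      have n1: "n \<ge> 1" "n \<le> N" "N \<le> 2 * n" using n N by auto
      have Ln: "L (real N) \<le> exp 1 * L (real n)"
        using X[of "real n"] n1 N by auto
      have "?u \<le> (exp 1 * L (real n)) * real n powr - \<alpha>"
        using Ln LN n1 \<alpha> by (intro mult_mono powr_mono2') auto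
      also have "\<dots> = exp 1 * (real n * p n)"
        using n1 p_eq[of n] by (simp add: powr_add powr_minus_divide)
      finally show ?thesis by (simp add: divide_le_eq mult.commute)
    qed
    have "real N / 2 * (?u / exp 1) \<le> real (card {(N + 1) div 2..N}) * (?u / exp 1)"
      using LN by (intro mult_right_mono) auto
    also have "\<dots> \<le> (\<Sum>n\<in>{(N + 1) div 2..N}. real n * p n)"
      using sum_mono[of "{(N + 1) div 2..N}" "\<lambda>_. ?u / exp 1" "\<lambda>n. real n * p n"] n_p by simp
    also have "\<dots> \<le> (\<Sum>n=1..N. real n * p n)"
      using N p_nonneg by (intro sum_mono2) auto
    also have "\<dots> \<le> m N" by (rule sum_first_moment_le[OF F_step])
    finally have "real N / 2 * (?u / exp 1) \<le> m N" .
    then have "?u \<le> 2 * exp 1 * b N"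
      using N by (simp add: b_def field_simps)
    moreover have "b N > 0" using m_ge_1[OF N(1)] N by (simp add: b_def)
    ultimately show ?case by (simp add: divide_le_eq)
  qed
qed

text \<open>For \<alpha> < 1 the ratio to \<open>b N\<close> is eventually bounded, hence bounded.
  For \<alpha> \<ge> 1 with finite mean, \<open>m N \<ge> 1\<close> is enough. Otherwise \<alpha> =
  1 and the logarithmic sum is a partial first moment.\<close>

lemma critical_scale_le:
  assumes \<mu>: "\<mu> = (\<integral>\<^sup>+ x. ennreal_of_enat (\<xi> 0 x) \<partial>M)"
  obtains C where "C \<ge> 0" "\<And>N. N \<ge> 1 \<Longrightarrow> critical_scale \<alpha> L \<mu> N \<le> C * b N"
proof -
  have b_pos: "b N > 0" if "N \<ge> 1" for N
    using m_ge_1[OF that] that by (simp add: b_def)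
  show thesis
  proof (cases "\<alpha> < 1")
    case True
    obtain B where B: "\<And>N. L (real N) * real N powr - \<alpha> / b N \<le> B"
      using eventually_le_imp_bounded[OF eventually_regular_scale_le] by blast
    have "critical_scale \<alpha> L \<mu> N \<le> max 0 B * b N" if N: "N \<ge> 1" for N
    proof -
      have "L (real N) * real N powr - \<alpha> \<le> B * b N"
        using B[of N] b_pos[OF N] by (simp add: divide_le_eq)
      also have "\<dots> \<le> max 0 B * b N" using b_pos[OF N] by (intro mult_right_mono) auto
      finally show ?thesis using True by (simp add: critical_scale_def)
    qed
    then show thesis using that[of "max 0 B"] by simp
  next
    case ge1: False
    show thesis
    proof (cases "\<mu> < \<infinity>")
      case True
      have "critical_scale \<alpha> L \<mu> N \<le> 1 * b N" if "N \<ge> 1" for N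
        using True ge1 m_ge_1[OF that] that
        by (simp add: critical_scale_def b_def powr_minus_divide divide_right_mono)
      then show thesis using that[of 1] by simp
    next
      case False
      \<comment> \<open>For \<alpha> > 1 there is a halving factor below 1/2, which bounds the
        truncated means and makes the mean finite.\<close>
      have "\<alpha> = 1"
      proof (rule ccontr)
        assume "\<alpha> \<noteq> 1"
        then have "\<alpha> > 1" using ge1 by simp
        then have lt: "2 powr - \<alpha> < (1 / 2 :: real)"
          using powr_less_mono[of "- \<alpha>" "- 1" 2] by (simp add: powr_minus_divide)
        then obtain \<rho> :: real where \<rho>: "2 powr - \<alpha> < \<rho>" "\<rho> < 1 / 2" using dense by blast
        have "0 \<le> \<rho>" using \<rho>(1) powr_ge_zero[of 2 "- \<alpha>"] by linarith
        then obtain B where "\<And>n. m n \<le> B"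
          using m_bounded[OF halving[OF \<rho>(1)] _ \<rho>(2)] by blast
        then show False using mean_finite_if_bounded False \<mu> by blast
      qed
      have "critical_scale \<alpha> L \<mu> N \<le> 1 * b N" if "N \<ge> 1" for N
        using False ge1 log_partial_sum_le[OF \<open>\<alpha> = 1\<close>, of N] that
        by (simp add: critical_scale_def b_def powr_minus_divide divide_right_mono)
      then show thesis using that[of 1] by simp
    qed
  qed
qed

lemma critical_scale_nonneg: "critical_scale \<alpha> L \<mu> N \<ge> 0" if "N \<ge> 1"
proof -
  have "L (real n) \<ge> 0" if "n \<ge> 1" for n
    using slowly_varying_pos[OF sv, of "real n"] that by simp
  then have "log_partial_sum L N \<ge> 0" "L (real N) \<ge> 0"
    unfolding log_partial_sum_def using that by (auto intro!: sum_nonneg divide_nonneg_nonneg)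
  then show ?thesis by (simp add: critical_scale_def)
qed

text \<open>Any halving factor strictly between \<open>2 powr - \<alpha>\<close> and
  \<open>2 powr (\<kappa> - 1)\<close> serves in \<open>m_regular\<close>; such a factor exists
  because \<open>1 - \<alpha> < \<kappa>\<close>.\<close>

lemma truncated_mean_regular:
  assumes \<kappa>: "\<kappa> \<ge> 0" "1 - \<alpha> < \<kappa>" "\<kappa> < 1"
  obtains C where "regular_renewal M \<xi> C \<kappa>"
proof -
  have "2 powr - \<alpha> < (2 powr (\<kappa> - 1) :: real)"
    using \<kappa> by (intro powr_less_mono) auto
  then obtain \<rho> :: real where \<rho>: "2 powr - \<alpha> < \<rho>" "\<rho> < 2 powr (\<kappa> - 1)" using dense by blast
  have "0 \<le> \<rho>" using \<rho>(1) powr_ge_zero[of 2 "- \<alpha>"] by linarith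
  moreover have "2 * \<rho> < 2 powr \<kappa>" using \<rho>(2) by (simp add: powr_diff)
  ultimately obtain C where C: "C \<ge> 1"
    "\<And>n N. 1 \<le> n \<Longrightarrow> n \<le> N \<Longrightarrow> m N \<le> C * (real N / real n) powr \<kappa> * m n"
    using m_regular[OF halving[OF \<rho>(1)] _ _ \<kappa>(1)] by metis
  have "regular_renewal M \<xi> C \<kappa>"
    by unfold_locales (use C \<kappa> in auto)
  then show thesis by (rule that)
qed

end

section \<open>Mixture representation of the partition function and conclusion\<close>

lemma (in renewal) wick_partition_eq:
  assumes \<tau>: "\<And>i x. x \<in> space M \<Longrightarrow> \<tau> i x = T i x" and "disorder P \<omega> \<gamma>"
  shows "wick_partition M \<tau> \<gamma> (\<lambda>n. \<omega> n w) h \<beta> N =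
    (\<Sum>S\<in>Pow {1..N}. q N S * exp (h * real (card S)) * disorder.wick \<omega> \<gamma> \<beta> S w)"
proof -
  interpret D: disorder P \<omega> \<gamma> by fact
  have "wick_partition M \<tau> \<gamma> (\<lambda>n. \<omega> n w) h \<beta> N =
      expectation (\<lambda>x. exp (h * real (card (R N x))) * D.wick \<beta> (R N x) w)"
    unfolding wick_partition_def
  proof (rule Bochner_Integration.integral_cong[OF refl])
    fix x assume x: "x \<in> space M"
    have ind: "indicator (renewal_set \<tau> x) n = (indicator (R N x) n :: real)" if "n \<in> {1..N}" for n
      using that \<tau>[OF x] by (auto simp: R_def renewal_set_def indicator_def)
    have sum_ind: "(\<Sum>n=1..N. f n * indicator (R N x) n) = (\<Sum>n\<in>R N x. f n)" for f :: "nat \<Rightarrow> real"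
      using R_subset[of N x] by (intro sum.mono_neutral_cong_right) (auto simp: indicator_def)
    have "(\<Sum>n=1..N. (\<beta> * \<omega> n w + h) * indicator (renewal_set \<tau> x) n)
        = (\<Sum>n=1..N. (\<beta> * \<omega> n w + h) * indicator (R N x) n)"
      using ind by (intro sum.cong) auto
    also have "\<dots> = \<beta> * (\<Sum>n\<in>R N x. \<omega> n w) + h * real (card (R N x))"
      by (simp only: sum_ind) (simp add: sum.distrib sum_distrib_left)
    finally have lin: "(\<Sum>n=1..N. (\<beta> * \<omega> n w + h) * indicator (renewal_set \<tau> x) n)
        = \<beta> * (\<Sum>n\<in>R N x. \<omega> n w) + h * real (card (R N x))" .
    have "(\<Sum>n=1..N. \<Sum>m=1..N. \<gamma> (int n - int m) * indicator (renewal_set \<tau> x) n * indicator (renewal_set \<tau> x) m)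
        = (\<Sum>n=1..N. (\<Sum>m=1..N. \<gamma> (int n - int m) * indicator (R N x) m) * indicator (R N x) n)"
      unfolding sum_distrib_right using ind by (intro sum.cong) (auto simp: mult_ac)
    also have "\<dots> = D.energy (R N x) (R N x)"
      unfolding D.energy_def by (simp only: sum_ind)
    finally have quad: "(\<Sum>n=1..N. \<Sum>m=1..N. \<gamma> (int n - int m) * indicator (renewal_set \<tau> x) n * indicator (renewal_set \<tau> x) m)
        = D.energy (R N x) (R N x)" .
    show "exp ((\<Sum>n=1..N. (\<beta> * \<omega> n w + h) * indicator (renewal_set \<tau> x) n) - 1 / 2 * \<beta>\<^sup>2 *
          (\<Sum>n=1..N. \<Sum>m=1..N. \<gamma> (int n - int m) * indicator (renewal_set \<tau> x) n * indicator (renewal_set \<tau> x) m))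
        = exp (h * real (card (R N x))) * D.wick \<beta> (R N x) w"
      unfolding lin quad D.wick_def mult_exp_exp by (simp add: algebra_simps)
  qed
  also have "\<dots> = (\<Sum>S\<in>Pow {1..N}. q N S * (exp (h * real (card S)) * D.wick \<beta> S w))"
    by (rule expectation_R)
  finally show ?thesis by (simp only: mult.assoc)
qed

text \<open>Swapping the sums exhibits the potential of \<open>S\<close> at the points of
  \<open>S'\<close>, the form of the exponent used in \<open>tilted_tail_small\<close>.\<close>

lemma (in disorder) energy_le_interaction:
  assumes \<gamma>: "\<And>k. \<gamma> k \<le> C * correlation_bound H k" and C: "C \<ge> 0" and H: "H < 1"
  shows "energy S S' \<le> C * 2 powr (2 - 2 * H) * (\<Sum>m\<in>S'. interaction (2 - 2 * H) S m)"
proof -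
  have "energy S S' = (\<Sum>m\<in>S'. \<Sum>n\<in>S. \<gamma> (int n - int m))"
    unfolding energy_def by (rule sum.swap)
  also have "\<dots> \<le> (\<Sum>m\<in>S'. \<Sum>n\<in>S. C * 2 powr (2 - 2 * H) * (\<bar>real m - real n\<bar> + 1) powr - (2 - 2 * H))"
  proof (intro sum_mono)
    fix m n
    have "\<gamma> (int n - int m) \<le> C * correlation_bound H (int n - int m)" by (rule \<gamma>)
    also have "\<dots> \<le> C * (2 powr (2 - 2 * H) * (\<bar>real n - real m\<bar> + 1) powr - (2 - 2 * H))"
      by (intro mult_left_mono correlation_bound_le H C)
    finally show "\<gamma> (int n - int m) \<le> C * 2 powr (2 - 2 * H) * (\<bar>real m - real n\<bar> + 1) powr - (2 - 2 * H)"
      by (simp add: abs_minus_commute mult.assoc)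
  qed
  also have "\<dots> = C * 2 powr (2 - 2 * H) * (\<Sum>m\<in>S'. interaction (2 - 2 * H) S m)"
    by (simp add: interaction_def sum_distrib_left)
  finally show ?thesis .
qed

theorem proposition3p5:
  fixes M :: "'a measure" and \<tau> :: "nat \<Rightarrow> 'a \<Rightarrow> enat"
    and P :: "'b measure" and \<omega> :: "nat \<Rightarrow> 'b \<Rightarrow> real"
    and \<gamma> :: "int \<Rightarrow> real" and L :: "real \<Rightarrow> real"
    and \<alpha> H \<beta>0 h0 :: real
  assumes "slowly_varying L"
    and "renewal_process M \<tau>"
    and "\<And>n::nat. n \<ge> 1 \<Longrightarrow>
           measure M {x \<in> space M. \<tau> 1 x = enat n} = L (real n) / real n powr (1 + \<alpha>)"
    and "measure M {x \<in> space M. \<tau> 1 x < \<infinity>} = 1"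
    and "gaussian_disorder P \<omega> \<gamma> H"
    and "1 / 2 < H" and "H < 1" and "\<alpha> > 0" and "\<alpha> + 2 * H > 2"
    and "\<beta>0 > 0"
  shows "uniformly_integrable P {1::nat..}
           (\<lambda>N w. wick_partition M \<tau> \<gamma> (\<lambda>n. \<omega> n w)
                    (pinning_scaling \<alpha> L (mean_return_time M \<tau>) h0 N)
                    (disorder_scaling \<alpha> H L (mean_return_time M \<tau>) \<beta>0 N) N)"
proof -
  obtain \<xi> where ps: "prob_space M"
    and \<xi>: "prob_space.indep_vars M (\<lambda>_. count_space UNIV) \<xi> UNIV"
      "\<And>i. distr M (count_space UNIV) (\<xi> i) = distr M (count_space UNIV) (\<xi> 0)"
      "\<And>i. AE x in M. 1 \<le> \<xi> i x"
    and \<tau>: "\<And>i x. x \<in> space M \<Longrightarrow> \<tau> i x = (\<Sum>j<i. \<xi> j x)"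
    using assms(2) unfolding renewal_process_def by blast
  have \<tau>1: "\<tau> 1 x = \<xi> 0 x" if "x \<in> space M" for x
    using \<tau>[OF that, of 1] by simp
  have ev: "{x \<in> space M. Q (\<tau> 1 x)} = {x \<in> space M. Q (\<xi> 0 x)}" for Q
    using \<tau>1 by auto
  interpret prob_space M by (rule ps)
  interpret regular_law M \<xi> L \<alpha>
  proof unfold_locales
    show "distr M (count_space UNIV) (\<xi> i) = distr M (count_space UNIV) (\<xi> 0)" for i by (rule \<xi>(2))
    show "measure M {x \<in> space M. \<xi> 0 x = enat n} = L (real n) / real n powr (1 + \<alpha>)" if "n \<ge> 1" for n
      using assms(3)[OF that] by (simp only: ev[of "\<lambda>e. e = enat n"])
    show "measure M {x \<in> space M. \<xi> 0 x < \<infinity>} = 1"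
      using assms(4) by (simp only: ev[of "\<lambda>e. e < \<infinity>"])
  qed (use assms \<xi> in auto)
  define s where "s = 2 - 2 * H"
  \<comment> \<open>The midpoint between max(0, 1 - \<alpha>) and 2H - 1. These are strictly ordered
    because \<alpha> + 2H > 2 and H > 1/2, and \<open>\<kappa> < 2 * H - 1\<close> is the condition
    \<open>\<kappa> + s < 1\<close>.\<close>
  define \<kappa> where "\<kappa> = (max 0 (1 - \<alpha>) + (2 * H - 1)) / 2"
  have s: "s \<ge> 0" "\<kappa> + s < 1" and \<kappa>: "\<kappa> \<ge> 0" "1 - \<alpha> < \<kappa>" "\<kappa> < 1"
    using assms(6-9) by (auto simp: s_def \<kappa>_def max_def field_simps)
  obtain C where "regular_renewal M \<xi> C \<kappa>" by (rule truncated_mean_regular[OF \<kappa>])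
  then interpret RR: regular_renewal M \<xi> C \<kappa> .
  interpret D: disorder P \<omega> \<gamma>
    using assms(5) unfolding gaussian_disorder_def
    by (intro disorder.intro disorder_axioms.intro) auto
  obtain Cg' where Cg': "\<And>k. \<gamma> k \<le> Cg' * correlation_bound H k"
    using assms(5) unfolding gaussian_disorder_def by blast
  \<comment> \<open>A nonnegative constant is taken so that the covariance bound can be multiplied
    and summed.\<close>
  define Cg where "Cg = max 0 Cg'"
  have Cg: "Cg \<ge> 0" "\<gamma> k \<le> Cg * correlation_bound H k" for k
  proof -
    show "Cg \<ge> 0" by (simp add: Cg_def)
    have "Cg' * correlation_bound H k \<le> Cg * correlation_bound H k"
      by (intro mult_right_mono) (auto simp: Cg_def correlation_bound_def)
    then show "\<gamma> k \<le> Cg * correlation_bound H k" using Cg'[of k] by simp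
  qed
  define \<mu> where "\<mu> = mean_return_time M \<tau>"
  have "\<mu> = (\<integral>\<^sup>+ x. ennreal_of_enat (\<xi> 0 x) \<partial>M)"
    unfolding \<mu>_def mean_return_time_def by (intro nn_integral_cong) (simp only: \<tau>1)
  then obtain Ca where Ca: "Ca \<ge> 0" "\<And>N. N \<ge> 1 \<Longrightarrow> critical_scale \<alpha> L \<mu> N \<le> Ca * b N"
    by (rule critical_scale_le) blast
  define h where "h N = pinning_scaling \<alpha> L \<mu> h0 N" for N
  define \<beta> where "\<beta> N = disorder_scaling \<alpha> H L \<mu> \<beta>0 N" for N
  define Z where "Z N w = wick_partition M \<tau> \<gamma> (\<lambda>n. \<omega> n w) (h N) (\<beta> N) N" for N w
  \<comment> \<open>Both constants are independent of \<open>N\<close>. The square of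
    \<open>N powr (1 - H)\<close> in the disorder scale is \<open>N powr s\<close> and is kept apart
    from \<open>c2\<close>, which also contains the constant of the energy bound.\<close>
  define c1 c2 where "c1 = \<bar>h0\<bar> * Ca" and "c2 = \<beta>0\<^sup>2 * Ca\<^sup>2 * (Cg * 2 powr s)"
  have c: "c1 \<ge> 0" "c2 \<ge> 0" using Ca Cg by (auto simp: c1_def c2_def)
  have Z_eq: "Z N w = (\<Sum>S\<in>Pow {1..N}. q N S * exp (h N * real (card S)) * D.wick (\<beta> N) S w)" for N w
    unfolding Z_def by (rule wick_partition_eq[where P = P]) (auto simp: \<tau> T_def D.disorder_axioms)
  have h_le: "\<bar>h N\<bar> \<le> c1 * b N" if "N \<ge> 1" for N
    using Ca(2)[OF that] critical_scale_nonneg[OF that, of \<mu>]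
    by (simp add: h_def pinning_scaling_eq c1_def abs_mult mult.assoc mult_left_mono)
  have e_le: "(\<beta> N)\<^sup>2 * D.energy S S' \<le> c2 * (b N)\<^sup>2 * real N powr s * (\<Sum>m\<in>S'. interaction s S m)"
    if N: "N \<ge> 1" for N S S'
  proof -
    have \<beta>2: "(\<beta> N)\<^sup>2 \<le> \<beta>0\<^sup>2 * Ca\<^sup>2 * (b N)\<^sup>2 * real N powr s"
    proof -
      have "(\<beta> N)\<^sup>2 = \<beta>0\<^sup>2 * (critical_scale \<alpha> L \<mu> N)\<^sup>2 * real N powr s"
        using N by (simp add: \<beta>_def disorder_scaling_eq power_mult_distrib powr_power s_def algebra_simps)
      also have "\<dots> \<le> \<beta>0\<^sup>2 * (Ca * b N)\<^sup>2 * real N powr s"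
        using Ca(2)[OF N] critical_scale_nonneg[OF N, of \<mu>]
        by (intro mult_right_mono mult_left_mono power_mono) auto
      finally show ?thesis by (simp add: power_mult_distrib mult_ac)
    qed
    have inter0: "0 \<le> (\<Sum>m\<in>S'. interaction s S m)"
      unfolding interaction_def by (intro sum_nonneg) auto
    have "(\<beta> N)\<^sup>2 * D.energy S S' \<le> (\<beta> N)\<^sup>2 * (Cg * 2 powr s * (\<Sum>m\<in>S'. interaction s S m))"
      unfolding s_def by (intro mult_left_mono D.energy_le_interaction Cg assms) auto
    also have "\<dots> \<le> (\<beta>0\<^sup>2 * Ca\<^sup>2 * (b N)\<^sup>2 * real N powr s) * (Cg * 2 powr s * (\<Sum>m\<in>S'. interaction s S m))"
      using \<beta>2 Cg inter0 by (intro mult_right_mono) auto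
    finally show ?thesis by (simp add: c2_def mult_ac)
  qed
  have tail: "(\<integral>\<^sup>+ w. ennreal \<bar>Z N w\<bar> * indicator {w. \<bar>Z N w\<bar> > K} w \<partial>P)
      \<le> ennreal (\<Sum>S\<in>Pow {1..N}. q N S * exp (h N * real (card S)) * min 1
        ((\<Sum>S'\<in>Pow {1..N}. q N S' * exp (h N * real (card S')) * exp ((\<beta> N)\<^sup>2 * D.energy S S')) / K))"
    if K: "K > 0" for N K
    unfolding Z_eq
  proof (rule D.mixture_tail)
    fix S assume "S \<in> Pow {1..N}"
    then have S: "S \<subseteq> {1..}" "finite S" by (auto intro: finite_subset)
    then show "has_bochner_integral P (D.wick (\<beta> N) S) 1" by (rule D.wick_mean)
    fix S' assume "S' \<in> Pow {1..N}"
    then have S': "S' \<subseteq> {1..}" "finite S'" by (auto intro: finite_subset)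
    show "has_bochner_integral P (\<lambda>w. D.wick (\<beta> N) S w * D.wick (\<beta> N) S' w) (exp ((\<beta> N)\<^sup>2 * D.energy S S'))"
      by (rule D.wick_product[OF S S'])
  qed (auto simp: q_nonneg D.wick_pos less_imp_le K)
  have "integrable P (Z N)" for N
    unfolding Z_eq[abs_def]
  proof (intro Bochner_Integration.integrable_sum integrable_mult_right)
    fix S assume "S \<in> Pow {1..N}"
    then have "S \<subseteq> {1..}" "finite S" by (auto intro: finite_subset)
    then show "integrable P (D.wick (\<beta> N) S)"
      using D.wick_mean by (auto simp: has_bochner_integral_iff)
  qed
  moreover have "((\<lambda>K. SUP N\<in>{1..}. \<integral>\<^sup>+ w. ennreal \<bar>Z N w\<bar> * indicator {w. \<bar>Z N w\<bar> > K} w \<partial>P)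
      \<longlongrightarrow> 0) (at_top :: real filter)"
  proof (rule order_tendstoI)
    fix \<eta> :: ennreal assume "\<eta> > 0"
    \<comment> \<open>As \<open>\<eta>\<close> may be infinite, a smaller finite level is
      chosen.\<close>
    then obtain e where e: "0 < e" "e < \<eta>" using dense by blast
    then obtain \<epsilon> where \<epsilon>': "e = ennreal \<epsilon>" by (cases e) auto
    then have \<epsilon>: "\<epsilon> > 0" "ennreal \<epsilon> < \<eta>" using e by (simp_all add: ennreal_less_zero_iff)
    obtain K0 where K0: "K0 > 0"
      "\<And>K N h e. \<lbrakk>K \<ge> K0; N \<ge> 1; \<bar>h\<bar> \<le> c1 * b N;
        \<And>S S'. S \<subseteq> {1..N} \<Longrightarrow> S' \<subseteq> {1..N} \<Longrightarrow>
          e S S' \<le> c2 * (b N)\<^sup>2 * real N powr s * (\<Sum>m\<in>S'. interaction s S m)\<rbrakk>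
      \<Longrightarrow> (\<Sum>S\<in>Pow {1..N}. q N S * exp (h * real (card S)) *
            min 1 ((\<Sum>S'\<in>Pow {1..N}. q N S' * exp (h * real (card S')) * exp (e S S')) / K)) \<le> \<epsilon>"
      by (rule RR.tilted_tail_small[OF s c \<epsilon>(1)]) blast
    have "(SUP N\<in>{1..}. \<integral>\<^sup>+ w. ennreal \<bar>Z N w\<bar> * indicator {w. \<bar>Z N w\<bar> > K} w \<partial>P) \<le> ennreal \<epsilon>"
      if K: "K \<ge> K0" for K
    proof (rule SUP_least)
      fix N :: nat assume "N \<in> {1..}"
      then have N: "N \<ge> 1" by simp
      have "(\<Sum>S\<in>Pow {1..N}. q N S * exp (h N * real (card S)) * min 1
        ((\<Sum>S'\<in>Pow {1..N}. q N S' * exp (h N * real (card S')) * exp ((\<beta> N)\<^sup>2 * D.energy S S')) / K)) \<le> \<epsilon>"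
        by (rule K0(2)[OF K N h_le[OF N] e_le[OF N]])
      then show "(\<integral>\<^sup>+ w. ennreal \<bar>Z N w\<bar> * indicator {w. \<bar>Z N w\<bar> > K} w \<partial>P) \<le> ennreal \<epsilon>"
        using tail[of K N] K K0(1) by (meson ennreal_leI less_le_trans order_trans)
    qed
    then have "\<forall>K\<ge>K0. (SUP N\<in>{1..}. \<integral>\<^sup>+ w. ennreal \<bar>Z N w\<bar> * indicator {w. \<bar>Z N w\<bar> > K} w \<partial>P) < \<eta>"
      using \<epsilon>(2) by (meson le_less_trans)
    then show "\<forall>\<^sub>F K in at_top. (SUP N\<in>{1..}. \<integral>\<^sup>+ w. ennreal \<bar>Z N w\<bar> * indicator {w. \<bar>Z N w\<bar> > K} w \<partial>P) < \<eta>"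
      unfolding eventually_at_top_linorder by blast
  qed simp
  ultimately have "uniformly_integrable P {1..} Z"
    unfolding uniformly_integrable_def by blast
  then show ?thesis
    unfolding Z_def[abs_def] h_def \<beta>_def \<mu>_def .
qed

end
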